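(* Let $\Omega\subset\mathbb{C}^n$ be a bounded domain and let $\mathcal R$ and $\mathcal R'$ be quasi-free Hilbert modules of finite rank $m$ over $A(\Omega)$ with generating sets $\{f_1,\dots,f_m\}$ and $\{f'_1,\dots,f'_m\}$ respectively, such that for every $z\in\Omega$ and all $i,j$, \[\langle f_i\otimes1_z,f_j\otimes1_z\rangle_{\mathcal R\otimes_{A(\Omega)}\mathbb C_z}=\langle f'_i\otimes1_z,f'_j\otimes1_z\rangle_{\mathcal R'\otimes_{A(\Omega)}\mathbb C_z}.\] Then $\delta(\mathcal R,\mathcal R')$ is an isometric module map and $\mathcal R$ and $\mathcal R'$ are unitarily equivalent.
   Context: $A(\Omega)$ is the closure, in the supremum norm on $\Omega$, of the set of functions holomorphic on some neighbourhood of $\overline\Omega$; $\ell^2_m$ is the $m$-dimensional Hilbert space. A quasi-free Hilbert module of rank $m$ over $A(\Omega)$ is a Hilbert space $\mathcal R$ obtained as the completion of $A(\Omega)\otimes\ell^2_m$ (regarded as $\ell^2_m$-valued holomorphic functions on $\Omega$) with respect to an inner product such that: (1) for each $z\in\Omega$ evaluation at $z$ is bounded, with norm locally uniformly bounded in $z$; (2) $\|\varphi F\|_{\mathcal R}\le\|\varphi\|_{A(\Omega)}\|F\|_{\mathcal R}$; (3) if $(F_i)$ is Cauchy in $\mathcal R$-norm, then $F_i(z)\to0$ for all $z$ iff $\|F_i\|_{\mathcal R}\to0$. $A(\Omega)$ acts by multiplication. For $z\in\Omega$, $\mathbb C_z$ is $\mathbb C$ with action $\varphi\cdot\lambda=\varphi(z)\lambda$;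 the localization $\mathcal R\otimes_{A(\Omega)}\mathbb C_z$ is the quotient Hilbert space $\mathcal R/\mathcal R_z$, $\mathcal R_z$ the closure of $\{\varphi h:\varphi(z)=0\}$, and $h\otimes1_z$ is the class of $h$. A generating set of $\mathcal R$ is $\{f_1,\dots,f_m\}\subset\mathcal R$ whose $A(\Omega)$-multiples span a dense subspace and such that $\{f_i\otimes1_z\}$ is a basis of $\mathcal R\otimes_{A(\Omega)}\mathbb C_z$ for each $z$. $\delta(\mathcal R,\mathcal R')$ is the (a priori unbounded, closed, densely defined) module transformation whose graph is the closure in $\mathcal R\oplus\mathcal R'$ of the span of $\{\varphi f_i\oplus\varphi f'_i:\varphi\in A(\Omega),1\le i\le m\}$ (so $\delta(\varphi f_i)=\varphi f'_i$). Unitary equivalence means there is a unitary $U:\mathcal R\to\mathcal R'$ commuting with the action of $A(\Omega)$. *)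

theory Defs
  imports "HOL-Analysis.Analysis" "HOL-Library.Function_Algebras"
begin

text \<open>Elements of a rank m module over A(Omega), Omega in C^n, are modelled as
  C^m-valued functions on C^n which vanish outside Omega.  n = CARD('n), m = CARD('m).\<close>

type_synonym ('n, 'm) vfun = "complex^'n \<Rightarrow> complex^'m"

definition holo_on :: "(complex^'n) set \<Rightarrow> (complex^'n \<Rightarrow> complex) \<Rightarrow> bool" where
  "holo_on U g \<longleftrightarrow> (\<forall>z\<in>U. \<exists>L. (g has_derivative L) (at z) \<and> (\<forall>c v. L (c *s v) = c * L v))"

text \<open>The algebra A(Omega): sup-norm closure on Omega of functions holomorphic
  on a neighbourhood of the closure of Omega (only the values on Omega matter).\<close>
definition A_alg :: "(complex^'n) set \<Rightarrow> (complex^'n \<Rightarrow> complex) set" where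
  "A_alg \<Omega> = {\<phi>. \<forall>e>0. \<exists>U g. open U \<and> closure \<Omega> \<subseteq> U \<and> holo_on U g \<and>
                        (\<forall>z\<in>\<Omega>. cmod (\<phi> z - g z) < e)}"

definition sup_norm :: "(complex^'n) set \<Rightarrow> (complex^'n \<Rightarrow> complex) \<Rightarrow> real" where
  "sup_norm \<Omega> \<phi> = (SUP z\<in>\<Omega>. cmod (\<phi> z))"

definition mult :: "(complex^'n \<Rightarrow> complex) \<Rightarrow> ('n::finite, 'm::finite) vfun \<Rightarrow> ('n::finite, 'm::finite) vfun" where
  "mult \<phi> F = (\<lambda>w. \<phi> w *s F w)"

definition smult_f :: "complex \<Rightarrow> ('n::finite, 'm::finite) vfun \<Rightarrow> ('n::finite, 'm::finite) vfun" where
  "smult_f c F = (\<lambda>w. c *s F w)"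

text \<open>A(Omega) tensor l^2_m, as l^2_m-valued functions on Omega.\<close>
definition A_tens :: "(complex^'n) set \<Rightarrow> ('n::finite, 'm::finite) vfun set" where
  "A_tens \<Omega> = {F. (\<forall>z. z \<notin> \<Omega> \<longrightarrow> F z = 0) \<and> (\<forall>i. (\<lambda>z. F z $ i) \<in> A_alg \<Omega>)}"

definition nrm :: "(('n::finite, 'm::finite) vfun \<Rightarrow> ('n::finite, 'm::finite) vfun \<Rightarrow> complex) \<Rightarrow> ('n::finite, 'm::finite) vfun \<Rightarrow> real" where
  "nrm ip F = sqrt (Re (ip F F))"

definition hclosure :: "('n::finite, 'm::finite) vfun set \<Rightarrow> (('n::finite, 'm::finite) vfun \<Rightarrow> ('n::finite, 'm::finite) vfun \<Rightarrow> complex)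
    \<Rightarrow> ('n::finite, 'm::finite) vfun set \<Rightarrow> ('n::finite, 'm::finite) vfun set" where
  "hclosure R ip S = {F\<in>R. \<forall>e>0. \<exists>G\<in>S. nrm ip (F - G) < e}"

definition fspan :: "('n::finite, 'm::finite) vfun set \<Rightarrow> ('n::finite, 'm::finite) vfun set" where
  "fspan S = {F. \<exists>(N::nat) (c::nat \<Rightarrow> complex) g. (\<forall>k<N. g k \<in> S) \<and> F = (\<lambda>w. \<Sum>k<N. c k *s g k w)}"

definition cauchy_in :: "('n::finite, 'm::finite) vfun set \<Rightarrow> (('n::finite, 'm::finite) vfun \<Rightarrow> ('n::finite, 'm::finite) vfun \<Rightarrow> complex)
    \<Rightarrow> (nat \<Rightarrow> ('n::finite, 'm::finite) vfun) \<Rightarrow> bool" where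
  "cauchy_in R ip X \<longleftrightarrow> (\<forall>i. X i \<in> R) \<and>
     (\<forall>e>0. \<exists>N. \<forall>i\<ge>N. \<forall>j\<ge>N. nrm ip (X i - X j) < e)"

definition hilbert_fun_space :: "(complex^'n) set \<Rightarrow> ('n::finite, 'm::finite) vfun set
    \<Rightarrow> (('n::finite, 'm::finite) vfun \<Rightarrow> ('n::finite, 'm::finite) vfun \<Rightarrow> complex) \<Rightarrow> bool" where
  "hilbert_fun_space \<Omega> R ip \<longleftrightarrow>
     (\<forall>F\<in>R. \<forall>z. z \<notin> \<Omega> \<longrightarrow> F z = 0) \<and>
     0 \<in> R \<and> (\<forall>F\<in>R. \<forall>G\<in>R. F + G \<in> R) \<and> (\<forall>c. \<forall>F\<in>R. smult_f c F \<in> R) \<and>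
     (\<forall>F\<in>R. \<forall>G\<in>R. \<forall>H\<in>R. ip (F + G) H = ip F H + ip G H) \<and>
     (\<forall>c. \<forall>F\<in>R. \<forall>G\<in>R. ip (smult_f c F) G = c * ip F G) \<and>
     (\<forall>F\<in>R. \<forall>G\<in>R. ip G F = cnj (ip F G)) \<and>
     (\<forall>F\<in>R. F \<noteq> 0 \<longrightarrow> Re (ip F F) > 0) \<and>
     (\<forall>X. cauchy_in R ip X \<longrightarrow> (\<exists>F\<in>R. (\<lambda>i. nrm ip (X i - F)) \<longlonglongrightarrow> 0))"

definition quasi_free :: "(complex^'n) set \<Rightarrow> ('n::finite, 'm::finite) vfun set
    \<Rightarrow> (('n::finite, 'm::finite) vfun \<Rightarrow> ('n::finite, 'm::finite) vfun \<Rightarrow> complex) \<Rightarrow> bool" where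
  "quasi_free \<Omega> R ip \<longleftrightarrow>
     hilbert_fun_space \<Omega> R ip \<and>
     A_tens \<Omega> \<subseteq> R \<and> hclosure R ip (A_tens \<Omega>) = R \<and>
     \<comment> \<open>(1) bounded evaluation, locally uniformly in z\<close>
     (\<forall>z\<in>\<Omega>. \<exists>r>0. \<exists>C. \<forall>w\<in>\<Omega> \<inter> ball z r. \<forall>F\<in>R. norm (F w) \<le> C * nrm ip F) \<and>
     \<comment> \<open>(2) module action by multiplication, contractive\<close>
     (\<forall>\<phi>\<in>A_alg \<Omega>. \<forall>F\<in>R. mult \<phi> F \<in> R \<and> nrm ip (mult \<phi> F) \<le> sup_norm \<Omega> \<phi> * nrm ip F) \<and>
     \<comment> \<open>(3)\<close>
     (\<forall>X. cauchy_in R ip X \<longrightarrow>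
        ((\<forall>z\<in>\<Omega>. (\<lambda>i. X i z) \<longlonglongrightarrow> 0) \<longleftrightarrow> (\<lambda>i. nrm ip (X i)) \<longlonglongrightarrow> 0))"

definition R_sub :: "(complex^'n) set \<Rightarrow> ('n::finite, 'm::finite) vfun set
    \<Rightarrow> (('n::finite, 'm::finite) vfun \<Rightarrow> ('n::finite, 'm::finite) vfun \<Rightarrow> complex) \<Rightarrow> complex^'n \<Rightarrow> ('n::finite, 'm::finite) vfun set" where
  "R_sub \<Omega> R ip z = hclosure R ip (fspan {mult \<phi> h | \<phi> h. \<phi> \<in> A_alg \<Omega> \<and> \<phi> z = 0 \<and> h \<in> R})"

text \<open>The localization R/R_z is identified isometrically with the orthogonal
  complement of R_z: the class of h is represented by the unique u in h + R_z
  orthogonal to R_z, and the quotient inner product is that of representatives.\<close>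
definition loc_rep :: "(complex^'n) set \<Rightarrow> ('n::finite, 'm::finite) vfun set
    \<Rightarrow> (('n::finite, 'm::finite) vfun \<Rightarrow> ('n::finite, 'm::finite) vfun \<Rightarrow> complex) \<Rightarrow> complex^'n \<Rightarrow> ('n::finite, 'm::finite) vfun \<Rightarrow> ('n::finite, 'm::finite) vfun" where
  "loc_rep \<Omega> R ip z h = (THE u. u \<in> R \<and> h - u \<in> R_sub \<Omega> R ip z \<and> (\<forall>g\<in>R_sub \<Omega> R ip z. ip u g = 0))"

definition loc_ip :: "(complex^'n) set \<Rightarrow> ('n::finite, 'm::finite) vfun set
    \<Rightarrow> (('n::finite, 'm::finite) vfun \<Rightarrow> ('n::finite, 'm::finite) vfun \<Rightarrow> complex) \<Rightarrow> complex^'n \<Rightarrow> ('n::finite, 'm::finite) vfun \<Rightarrow> ('n::finite, 'm::finite) vfun \<Rightarrow> complex" where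
  "loc_ip \<Omega> R ip z h k = ip (loc_rep \<Omega> R ip z h) (loc_rep \<Omega> R ip z k)"

definition generating_set :: "(complex^'n) set \<Rightarrow> ('n::finite, 'm::finite) vfun set
    \<Rightarrow> (('n::finite, 'm::finite) vfun \<Rightarrow> ('n::finite, 'm::finite) vfun \<Rightarrow> complex) \<Rightarrow> ('m \<Rightarrow> ('n::finite, 'm::finite) vfun) \<Rightarrow> bool" where
  "generating_set \<Omega> R ip f \<longleftrightarrow>
     (\<forall>i. f i \<in> R) \<and>
     hclosure R ip (fspan {mult \<phi> (f i) | \<phi> i. \<phi> \<in> A_alg \<Omega>}) = R \<and>
     (\<forall>z\<in>\<Omega>.
        (\<forall>h\<in>R. \<exists>c::'m \<Rightarrow> complex. h - (\<lambda>w. \<Sum>i\<in>UNIV. c i *s f i w) \<in> R_sub \<Omega> R ip z) \<and>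
        (\<forall>c::'m \<Rightarrow> complex. (\<lambda>w. \<Sum>i\<in>UNIV. c i *s f i w) \<in> R_sub \<Omega> R ip z \<longrightarrow> (\<forall>i. c i = 0)))"

definition delta_graph :: "(complex^'n) set
    \<Rightarrow> ('n::finite, 'm::finite) vfun set \<Rightarrow> (('n::finite, 'm::finite) vfun \<Rightarrow> ('n::finite, 'm::finite) vfun \<Rightarrow> complex)
    \<Rightarrow> ('n::finite, 'm::finite) vfun set \<Rightarrow> (('n::finite, 'm::finite) vfun \<Rightarrow> ('n::finite, 'm::finite) vfun \<Rightarrow> complex)
    \<Rightarrow> ('m \<Rightarrow> ('n::finite, 'm::finite) vfun) \<Rightarrow> ('m \<Rightarrow> ('n::finite, 'm::finite) vfun) \<Rightarrow> (('n::finite, 'm::finite) vfun \<times> ('n::finite, 'm::finite) vfun) set" where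
  "delta_graph \<Omega> R ip R' ip' f f' =
     (let S = {(h, h'). \<exists>(N::nat) (c::nat \<Rightarrow> complex) \<phi> (i::nat \<Rightarrow> 'm). (\<forall>k<N. \<phi> k \<in> A_alg \<Omega>) \<and>
                  h = (\<lambda>w. \<Sum>k<N. c k *s mult (\<phi> k) (f (i k)) w) \<and>
                  h' = (\<lambda>w. \<Sum>k<N. c k *s mult (\<phi> k) (f' (i k)) w)}
      in {(h, h'). h \<in> R \<and> h' \<in> R' \<and>
            (\<forall>e>0. \<exists>(g, g')\<in>S. sqrt ((nrm ip (h - g))\<^sup>2 + (nrm ip' (h' - g'))\<^sup>2) < e)})"

definition isometric_module_map :: "(complex^'n) set
    \<Rightarrow> ('n::finite, 'm::finite) vfun set \<Rightarrow> (('n::finite, 'm::finite) vfun \<Rightarrow> ('n::finite, 'm::finite) vfun \<Rightarrow> complex)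
    \<Rightarrow> ('n::finite, 'm::finite) vfun set \<Rightarrow> (('n::finite, 'm::finite) vfun \<Rightarrow> ('n::finite, 'm::finite) vfun \<Rightarrow> complex)
    \<Rightarrow> (('n::finite, 'm::finite) vfun \<times> ('n::finite, 'm::finite) vfun) set \<Rightarrow> bool" where
  "isometric_module_map \<Omega> R ip R' ip' G \<longleftrightarrow>
     (\<exists>T. (\<forall>h\<in>R. T h \<in> R') \<and> G = {(h, T h) | h. h \<in> R} \<and>
          (\<forall>h\<in>R. \<forall>k\<in>R. T (h + k) = T h + T k) \<and>
          (\<forall>c. \<forall>h\<in>R. T (smult_f c h) = smult_f c (T h)) \<and>
          (\<forall>h\<in>R. nrm ip' (T h) = nrm ip h) \<and>
          (\<forall>\<phi>\<in>A_alg \<Omega>. \<forall>h\<in>R. T (mult \<phi> h) = mult \<phi> (T h)))"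

definition unitarily_equiv :: "(complex^'n) set
    \<Rightarrow> ('n::finite, 'm::finite) vfun set \<Rightarrow> (('n::finite, 'm::finite) vfun \<Rightarrow> ('n::finite, 'm::finite) vfun \<Rightarrow> complex)
    \<Rightarrow> ('n::finite, 'm::finite) vfun set \<Rightarrow> (('n::finite, 'm::finite) vfun \<Rightarrow> ('n::finite, 'm::finite) vfun \<Rightarrow> complex) \<Rightarrow> bool" where
  "unitarily_equiv \<Omega> R ip R' ip' \<longleftrightarrow>
     (\<exists>U. bij_betw U R R' \<and>
          (\<forall>h\<in>R. \<forall>k\<in>R. U (h + k) = U h + U k) \<and>
          (\<forall>c. \<forall>h\<in>R. U (smult_f c h) = smult_f c (U h)) \<and>
          (\<forall>h\<in>R. \<forall>k\<in>R. ip' (U h) (U k) = ip h k) \<and>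
          (\<forall>\<phi>\<in>A_alg \<Omega>. \<forall>h\<in>R. U (mult \<phi> h) = mult \<phi> (U h)))"

end

theory Submission
  imports Defs "HOL-Complex_Analysis.Conformal_Mappings" "HOL-Real_Asymp.Real_Asymp"
begin

text \<open>Counting dimensions, the submodule R_z is exactly the set of functions vanishing at z, so
  the localization at z is the fibre at z.  Expanding functions in the frame f 1, ..., f m, the
  reproducing kernel of R becomes a matrix L z w, holomorphic in z and antiholomorphic in w, whose
  diagonal value L z z is the inverse Gram matrix of the localized generators.  Hence the kernels of
  R and R' agree on the diagonal, and by polarization and the identity theorem everywhere.  The map
  T preserving the coordinates in the two frames therefore sends kernel functions to kernel
  functions and is isometric on their span, which is dense; and T maps each f i to f' i, so its
  graph is that of delta.\<close>

section \<open>Projections and the Riesz representation\<close>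

text \<open>Equality of the localized Gram matrices compares the modules only fibre by fibre, and a
  norm in R need not be computable from fibre norms. The reproducing kernel bridges this gap: it
  determines the inner product, while its diagonal is visible in the fibres. Writing it in the two
  frames is essential, since values of functions in R and in R' refer to unrelated trivializations
  of the fibres. The obstacle at the end is that T h is at first merely a function on
  \<open>\<Omega>\<close>, not known to lie in R'; nor is the isometry visible on the products of
  elements of A(Omega) with f i, whose images are known. So the good behaviour of T is packed into a
  condition that defines a closed subspace; it contains all kernel functions and therefore is R. In
  several variables, holomorphy is used only along complex lines. This notion is stable under
  locally uniform limits, determinants and quotients by one-variable arguments, and it suffices for
  polarization and the identity theorem; the price is that local bounds of the frame coefficients
  are available only along lines.\<close>

locale hilbert_functions =
  fixes \<Omega> :: "(complex^'n::finite) set"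
    and R :: "('n, 'm::finite) vfun set"
    and ip :: "('n, 'm) vfun \<Rightarrow> ('n, 'm) vfun \<Rightarrow> complex"
  assumes hilbert: "hilbert_fun_space \<Omega> R ip"
begin

section \<open>Inner product calculus\<close>

lemma
  shows outside [simp]: "F \<in> R \<Longrightarrow> z \<notin> \<Omega> \<Longrightarrow> F z = 0"
    and zero_mem [simp]: "0 \<in> R"
    and add_mem [simp]: "F \<in> R \<Longrightarrow> G \<in> R \<Longrightarrow> F + G \<in> R"
    and smult_mem [simp]: "F \<in> R \<Longrightarrow> smult_f c F \<in> R"
    and ip_add: "F \<in> R \<Longrightarrow> G \<in> R \<Longrightarrow> H \<in> R \<Longrightarrow> ip (F + G) H = ip F H + ip G H"
    and ip_smult: "F \<in> R \<Longrightarrow> G \<in> R \<Longrightarrow> ip (smult_f c F) G = c * ip F G"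
    and ip_cnj: "F \<in> R \<Longrightarrow> G \<in> R \<Longrightarrow> ip G F = cnj (ip F G)"
    and ip_pos: "F \<in> R \<Longrightarrow> F \<noteq> 0 \<Longrightarrow> Re (ip F F) > 0"
  using hilbert unfolding hilbert_fun_space_def by metis+

lemma complete: "cauchy_in R ip X \<Longrightarrow> \<exists>F\<in>R. (\<lambda>i. nrm ip (X i - F)) \<longlonglongrightarrow> 0"
  using hilbert unfolding hilbert_fun_space_def by blast

text \<open>\<open>hilbert_fun_space\<close> speaks of sums and scalar multiples only; every fact on
  differences passes through this identity.\<close>

lemma diff_as_add: "F - G = F + smult_f (-1) (G :: ('n, 'm) vfun)"
  by (simp add: fun_eq_iff smult_f_def vec_eq_iff)

lemma diff_mem [simp]: "F \<in> R \<Longrightarrow> G \<in> R \<Longrightarrow> F - G \<in> R"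
  by (simp add: diff_as_add)

lemma ip_add_right: "F \<in> R \<Longrightarrow> G \<in> R \<Longrightarrow> H \<in> R \<Longrightarrow> ip H (F + G) = ip H F + ip H G"
  by (simp add: ip_cnj[of _ H] ip_add)

lemma ip_smult_right: "F \<in> R \<Longrightarrow> G \<in> R \<Longrightarrow> ip G (smult_f c F) = cnj c * ip G F"
  by (simp add: ip_cnj[of _ G] ip_smult)

lemma ip_diff: "F \<in> R \<Longrightarrow> G \<in> R \<Longrightarrow> H \<in> R \<Longrightarrow> ip (F - G) H = ip F H - ip G H"
  by (simp add: diff_as_add ip_add ip_smult)

lemma ip_diff_right: "F \<in> R \<Longrightarrow> G \<in> R \<Longrightarrow> H \<in> R \<Longrightarrow> ip H (F - G) = ip H F - ip H G"
  by (simp add: diff_as_add ip_add_right ip_smult_right)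

lemma ip_zero: "F \<in> R \<Longrightarrow> ip 0 F = 0"
  using ip_add[of 0 0 F] by simp

lemma ip_self: "F \<in> R \<Longrightarrow> ip F F = of_real ((nrm ip F)\<^sup>2)"
proof -
  assume F: "F \<in> R"
  then have "Im (ip F F) = 0"
    using arg_cong[OF ip_cnj[of F F], of Im] by simp
  moreover have "0 \<le> Re (ip F F)"
    using F ip_pos[of F] ip_zero[of 0] by (cases "F = 0") auto
  ultimately show ?thesis
    by (simp add: nrm_def complex_eq_iff)
qed

lemma nrm_sq: "F \<in> R \<Longrightarrow> (nrm ip F)\<^sup>2 = Re (ip F F)"
  by (simp add: ip_self del: of_real_power)

lemma nrm_nonneg [simp]: "F \<in> R \<Longrightarrow> 0 \<le> nrm ip F"
  using ip_self[of F] ip_pos[of F] ip_zero[of 0] by (cases "F = 0") (auto simp: nrm_def)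

lemma nrm_eq_0: "F \<in> R \<Longrightarrow> nrm ip F = 0 \<longleftrightarrow> F = 0"
  using ip_self[of F] ip_pos[of F] ip_zero[of 0] by (cases "F = 0") (auto simp: nrm_def)

lemma ip_self_eq_0: "F \<in> R \<Longrightarrow> ip F F = 0 \<Longrightarrow> F = 0"
  using ip_pos[of F] by fastforce

lemma nrm_diff_sq:
  "F \<in> R \<Longrightarrow> G \<in> R \<Longrightarrow> (nrm ip (F - G))\<^sup>2 = (nrm ip F)\<^sup>2 + (nrm ip G)\<^sup>2 - 2 * Re (ip F G)"
  by (simp add: nrm_sq ip_diff ip_diff_right ip_cnj[of F G] algebra_simps)

lemma nrm_smult: "F \<in> R \<Longrightarrow> nrm ip (smult_f c F) = cmod c * nrm ip F"
proof -
  assume F: "F \<in> R"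
  have "complex_of_real ((nrm ip (smult_f c F))\<^sup>2) = of_real ((cmod c * nrm ip F)\<^sup>2)"
    using F by (simp add: ip_self[symmetric] ip_smult ip_smult_right power_mult_distrib
        complex_norm_square mult_ac del: of_real_power)
  then show ?thesis
    using F by (simp only: of_real_eq_iff) (auto simp: power2_eq_iff_nonneg)
qed

lemma cauchy_schwarz:
  assumes F: "F \<in> R" and G: "G \<in> R"
  shows "cmod (ip F G) \<le> nrm ip F * nrm ip G"
proof (cases "G = 0")
  case True
  then show ?thesis
    using F G ip_cnj[of G F] ip_zero[of F] by simp
next
  case False
  define g where "g = (nrm ip G)\<^sup>2"
  \<comment> \<open>With this \<open>t\<close>, \<open>smult_f t G\<close> is the orthogonal
    projection of \<open>F\<close> onto the line through \<open>G\<close>; the inequality says that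
    the remainder has nonnegative squared norm.\<close>
  define t where "t = ip F G / of_real g"
  have g: "g > 0"
    using False G nrm_eq_0[of G] nrm_nonneg[of G] by (simp add: g_def)
  have "ip F (smult_f t G) = of_real ((cmod (ip F G))\<^sup>2 / g)"
    using F G by (simp add: ip_smult_right t_def complex_norm_square del: of_real_power)
  then have "Re (ip F (smult_f t G)) = (cmod (ip F G))\<^sup>2 / g"
    by (metis Re_complex_of_real)
  moreover have "(nrm ip (smult_f t G))\<^sup>2 = (cmod (ip F G))\<^sup>2 / g"
    using G g by (simp add: nrm_smult t_def norm_divide power_mult_distrib power_divide
        flip: g_def) (simp add: power2_eq_square)
  ultimately have "0 \<le> (nrm ip F)\<^sup>2 - (cmod (ip F G))\<^sup>2 / g"
    using nrm_diff_sq[of F "smult_f t G"] F G zero_le_power2[of "nrm ip (F - smult_f t G)"] by simp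
  then have "(cmod (ip F G))\<^sup>2 \<le> (nrm ip F * nrm ip G)\<^sup>2"
    using g by (simp add: field_simps g_def power_mult_distrib)
  then show ?thesis
    by (rule power2_le_imp_le) (use F G in auto)
qed

lemma nrm_triangle_diff:
  assumes F: "F \<in> R" and G: "G \<in> R"
  shows "nrm ip (F - G) \<le> nrm ip F + nrm ip G"
proof -
  have "\<bar>Re (ip F G)\<bar> \<le> nrm ip F * nrm ip G"
    using cauchy_schwarz[OF F G] abs_Re_le_cmod order_trans by blast
  then have "(nrm ip (F - G))\<^sup>2 \<le> (nrm ip F + nrm ip G)\<^sup>2"
    using nrm_diff_sq[OF F G] by (simp add: power2_sum)
  then show ?thesis
    by (rule power2_le_imp_le) (use F G in auto)
qed

lemma nrm_minus_commute: "F \<in> R \<Longrightarrow> G \<in> R \<Longrightarrow> nrm ip (F - G) = nrm ip (G - F)"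
  using nrm_smult[of "F - G" "-1"] diff_as_add[of 0 "F - G"] by simp

lemma nrm_triangle3:
  assumes "F \<in> R" "G \<in> R" "H \<in> R"
  shows "nrm ip (F - G) \<le> nrm ip (F - H) + nrm ip (G - H)"
  using nrm_triangle_diff[of "F - H" "G - H"] assms by simp

lemma tendsto_ip:
  assumes X: "\<And>i. X i \<in> R" and F: "F \<in> R" and G: "G \<in> R"
    and lim: "(\<lambda>i. nrm ip (X i - F)) \<longlonglongrightarrow> 0"
  shows "(\<lambda>i. ip (X i) G) \<longlonglongrightarrow> ip F G"
proof -
  have "(\<lambda>i. ip (X i) G - ip F G) \<longlonglongrightarrow> 0"
  proof (rule Lim_null_comparison)
    show "\<forall>\<^sub>F i in sequentially. norm (ip (X i) G - ip F G) \<le> nrm ip (X i - F) * nrm ip G"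
      using cauchy_schwarz[of "X _ - F" G] X F G by (simp add: ip_diff)
    show "(\<lambda>i. nrm ip (X i - F) * nrm ip G) \<longlonglongrightarrow> 0"
      using tendsto_mult_right[OF lim, of "nrm ip G"] by simp
  qed
  then show ?thesis
    by (simp add: LIM_zero_iff)
qed

lemma tendsto_nrm:
  assumes X: "\<And>i. X i \<in> R" and F: "F \<in> R" and lim: "(\<lambda>i. nrm ip (X i - F)) \<longlonglongrightarrow> 0"
  shows "(\<lambda>i. nrm ip (X i)) \<longlonglongrightarrow> nrm ip F"
proof -
  have "(\<lambda>i. nrm ip (X i) - nrm ip F) \<longlonglongrightarrow> 0"
  proof (rule Lim_null_comparison)
    have "nrm ip (X i) \<le> nrm ip F + nrm ip (X i - F)" "nrm ip F \<le> nrm ip (X i) + nrm ip (X i - F)" for i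
      using nrm_triangle_diff[OF X diff_mem[OF X F], of i i] nrm_triangle_diff[OF F diff_mem[OF F X], of i]
        nrm_minus_commute[OF X F, of i] by simp_all
    then show "\<forall>\<^sub>F i in sequentially. norm (nrm ip (X i) - nrm ip F) \<le> nrm ip (X i - F)"
      by (simp add: abs_le_iff algebra_simps)
    show "(\<lambda>i. nrm ip (X i - F)) \<longlonglongrightarrow> 0"
      by (rule lim)
  qed
  then show ?thesis
    by (simp add: LIM_zero_iff)
qed

lemma convergent_imp_cauchy:
  assumes X: "\<And>i. X i \<in> R" and F: "F \<in> R" and lim: "(\<lambda>i. nrm ip (X i - F)) \<longlonglongrightarrow> 0"
  shows "cauchy_in R ip X"
  unfolding cauchy_in_def
proof (intro conjI allI impI)
  fix e :: real assume "e > 0"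
  then obtain N where N: "\<And>i. i \<ge> N \<Longrightarrow> nrm ip (X i - F) < e / 2"
    using order_tendstoD(2)[OF lim, of "e / 2"] by (auto simp: eventually_sequentially)
  then have "nrm ip (X i - X j) < e" if "i \<ge> N" "j \<ge> N" for i j
    using nrm_triangle3[of "X i" "X j" F] X F N[OF that(1)] N[OF that(2)] by simp
  then show "\<exists>N. \<forall>i\<ge>N. \<forall>j\<ge>N. nrm ip (X i - X j) < e" by blast
qed (use X in auto)

section \<open>Closed subspaces, orthogonal projection and Riesz representation\<close>

definition closed_subspace :: "('n, 'm) vfun set \<Rightarrow> bool" where
  "closed_subspace S \<longleftrightarrow> S \<subseteq> R \<and> 0 \<in> S \<and> (\<forall>F\<in>S. \<forall>G\<in>S. F + G \<in> S) \<and> (\<forall>c. \<forall>F\<in>S. smult_f c F \<in> S) \<and>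
     (\<forall>X F. (\<forall>i::nat. X i \<in> S) \<longrightarrow> F \<in> R \<longrightarrow> (\<lambda>i. nrm ip (X i - F)) \<longlonglongrightarrow> 0 \<longrightarrow> F \<in> S)"

lemma
  assumes "closed_subspace S"
  shows closed_subspace_mem: "F \<in> S \<Longrightarrow> F \<in> R"
    and closed_subspace_zero: "0 \<in> S"
    and closed_subspace_add: "F \<in> S \<Longrightarrow> G \<in> S \<Longrightarrow> F + G \<in> S"
    and closed_subspace_smult: "F \<in> S \<Longrightarrow> smult_f c F \<in> S"
    and closed_subspace_limit:
      "(\<And>i::nat. X i \<in> S) \<Longrightarrow> F \<in> R \<Longrightarrow> (\<lambda>i. nrm ip (X i - F)) \<longlonglongrightarrow> 0 \<Longrightarrow> F \<in> S"
  using assms unfolding closed_subspace_def by (blast | metis)+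

text \<open>A minimizing sequence is Cauchy by the parallelogram law, because midpoints of its terms
  stay in \<open>S\<close> and so cannot be closer to \<open>h\<close> than the infimum.\<close>

lemma closest_point_exists:
  assumes S: "closed_subspace S" and h: "h \<in> R"
  obtains v where "v \<in> S" "\<And>s. s \<in> S \<Longrightarrow> nrm ip (h - v) \<le> nrm ip (h - s)"
proof -
  note SR = closed_subspace_mem[OF S]
  define D where "D = (\<lambda>s. (nrm ip (h - s))\<^sup>2) ` S"
  define d where "d = Inf D"
  have ne: "D \<noteq> {}" and bdd: "bdd_below D"
    using closed_subspace_zero[OF S] by (auto simp: D_def intro!: bdd_belowI[of _ 0])
  have d_le: "d \<le> (nrm ip (h - s))\<^sup>2" if "s \<in> S" for s
    unfolding d_def using that by (intro cInf_lower bdd) (auto simp: D_def)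
  have "\<exists>s\<in>S. (nrm ip (h - s))\<^sup>2 < d + 1 / real (Suc n)" for n
    using cInf_less_iff[OF ne bdd, of "d + 1 / real (Suc n)"] by (auto simp: d_def D_def)
  then obtain X where X: "\<And>n. X n \<in> S" and Xd: "\<And>n. (nrm ip (h - X n))\<^sup>2 < d + 1 / real (Suc n)"
    by metis
  have XR: "X n \<in> R" for n using X SR by blast
  \<comment> \<open>By the parallelogram law the left side is twice the sum of the two squared
    distances to \<open>h\<close>, minus four times the squared distance from \<open>h\<close> to
    the midpoint. The last term is at least \<open>4 * d\<close>, which cancels the two
    contributions \<open>2 * d\<close>.\<close>
  have close: "(nrm ip (X i - X j))\<^sup>2 \<le> 2 / real (Suc i) + 2 / real (Suc j)" for i j
  proof -
    define M where "M = smult_f (1/2) (X i + X j)"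
    have M: "M \<in> S" using X S by (simp add: M_def closed_subspace_add closed_subspace_smult)
    have "h - M = smult_f (1/2) ((h - X i) + (h - X j))"
      by (auto simp: M_def smult_f_def fun_eq_iff vec_eq_iff field_simps)
    then have "nrm ip ((h - X i) + (h - X j)) = 2 * nrm ip (h - M)"
      by (simp only: nrm_smult[OF add_mem[OF diff_mem[OF h XR] diff_mem[OF h XR]]]) (simp add: norm_divide)
    then have "4 * (nrm ip (h - M))\<^sup>2 = (nrm ip ((h - X i) + (h - X j)))\<^sup>2"
      by (simp only: power_mult_distrib) simp
    also have "\<dots> = (nrm ip (h - X i))\<^sup>2 + (nrm ip (h - X j))\<^sup>2 + 2 * Re (ip (h - X i) (h - X j))"
      using ip_cnj[OF diff_mem[OF h XR[of i]] diff_mem[OF h XR[of j]]]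
      by (simp only: nrm_sq ip_add ip_add_right add_mem diff_mem h XR) simp
    finally have A: "4 * (nrm ip (h - M))\<^sup>2 = \<dots>" .
    have "(h - X i) - (h - X j) = X j - X i"
      by simp
    then have "(nrm ip (X i - X j))\<^sup>2 =
        (nrm ip (h - X i))\<^sup>2 + (nrm ip (h - X j))\<^sup>2 - 2 * Re (ip (h - X i) (h - X j))"
      using nrm_diff_sq[OF diff_mem[OF h XR] diff_mem[OF h XR], of i j] nrm_minus_commute[OF XR XR, of i j]
      by simp
    then show ?thesis
      using A d_le[OF M] Xd[of i] Xd[of j] by simp
  qed
  have "cauchy_in R ip X"
    unfolding cauchy_in_def
  proof (intro conjI allI impI)
    fix e :: real assume "e > 0"
    then obtain N where N: "4 / e\<^sup>2 < real (Suc N)"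
      using reals_Archimedean2[of "4 / e\<^sup>2"] by (meson less_trans of_nat_less_iff lessI)
    have "nrm ip (X i - X j) < e" if "i \<ge> N" "j \<ge> N" for i j
    proof -
      have "2 / real (Suc i) \<le> 2 / real (Suc N)" "2 / real (Suc j) \<le> 2 / real (Suc N)"
        using that by (auto intro!: divide_left_mono)
      then have "(nrm ip (X i - X j))\<^sup>2 \<le> 4 / real (Suc N)"
        using close[of i j] by simp
      also have "\<dots> < e\<^sup>2"
        using N \<open>e > 0\<close> by (simp add: field_simps)
      finally show ?thesis
        using \<open>e > 0\<close> power_less_imp_less_base[of _ 2 e] by simp
    qed
    then show "\<exists>N. \<forall>i\<ge>N. \<forall>j\<ge>N. nrm ip (X i - X j) < e" by blast
  qed (use XR in auto)
  then obtain v where v: "v \<in> R" and lim: "(\<lambda>i. nrm ip (X i - v)) \<longlonglongrightarrow> 0"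
    using complete by blast
  have vS: "v \<in> S"
    using closed_subspace_limit[OF S X v lim] .
  have "(\<lambda>i. nrm ip ((h - X i) - (h - v))) \<longlonglongrightarrow> 0"
    using lim nrm_minus_commute[OF XR v] by simp
  then have "(\<lambda>i. nrm ip (h - X i)) \<longlonglongrightarrow> nrm ip (h - v)"
    using tendsto_nrm[of "\<lambda>i. h - X i" "h - v"] h XR v by simp
  then have "(\<lambda>i. (nrm ip (h - X i))\<^sup>2) \<longlonglongrightarrow> (nrm ip (h - v))\<^sup>2"
    by (intro tendsto_power)
  moreover have "(\<lambda>n. d + 1 / real (Suc n)) \<longlonglongrightarrow> d + 0"
    by (intro tendsto_add tendsto_const LIMSEQ_Suc[OF lim_1_over_n])
  ultimately have "(nrm ip (h - v))\<^sup>2 \<le> d"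
    using Xd by (intro LIMSEQ_le[of _ _ "\<lambda>n. d + 1 / real (Suc n)"]) (auto intro: less_imp_le)
  then have "nrm ip (h - v) \<le> nrm ip (h - s)" if "s \<in> S" for s
    using d_le[OF that] power2_le_imp_le[of "nrm ip (h - v)" "nrm ip (h - s)"] h SR[OF that] by simp
  then show ?thesis
    using that vS by blast
qed

text \<open>If the remainder at the closest point had a nonzero product with some \<open>s\<close>
  in \<open>S\<close>, moving that point by the projection of the remainder onto \<open>s\<close>
  would bring it strictly closer to \<open>h\<close>.\<close>

lemma projection_exists:
  assumes S: "closed_subspace S" and h: "h \<in> R"
  obtains v where "v \<in> S" "\<And>s. s \<in> S \<Longrightarrow> ip (h - v) s = 0"
proof -
  obtain v where v: "v \<in> S" and min: "\<And>s. s \<in> S \<Longrightarrow> nrm ip (h - v) \<le> nrm ip (h - s)"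
    using closest_point_exists[OF assms] by blast
  note SR = closed_subspace_mem[OF S]
  have "ip (h - v) s = 0" if s: "s \<in> S" for s
  proof (cases "s = 0")
    case True
    then show ?thesis
      using ip_cnj[of 0 "h - v"] ip_zero[of "h - v"] h SR v by simp
  next
    case False
    define e where "e = h - v"
    define g where "g = (nrm ip s)\<^sup>2"
    define t where "t = ip e s / of_real g"
    have eR: "e \<in> R" and sR: "s \<in> R" using h SR v s by (auto simp: e_def)
    have g: "g > 0"
      using False sR nrm_eq_0[of s] nrm_nonneg[of s] by (simp add: g_def)
    have "ip e (smult_f t s) = of_real ((cmod (ip e s))\<^sup>2 / g)"
      using eR sR by (simp add: ip_smult_right t_def complex_norm_square del: of_real_power)
    then have "Re (ip e (smult_f t s)) = (cmod (ip e s))\<^sup>2 / g"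
      by (metis Re_complex_of_real)
    moreover have "(nrm ip (smult_f t s))\<^sup>2 = (cmod (ip e s))\<^sup>2 / g"
      using sR g by (simp add: nrm_smult t_def norm_divide power_mult_distrib power_divide
          flip: g_def) (simp add: power2_eq_square)
    ultimately have "(nrm ip (e - smult_f t s))\<^sup>2 = (nrm ip e)\<^sup>2 - (cmod (ip e s))\<^sup>2 / g"
      using nrm_diff_sq[of e "smult_f t s"] eR sR by simp
    moreover have "nrm ip e \<le> nrm ip (h - (v + smult_f t s))"
      unfolding e_def using S v s by (intro min closed_subspace_add closed_subspace_smult)
    then have "(nrm ip e)\<^sup>2 \<le> (nrm ip (e - smult_f t s))\<^sup>2"
      using eR sR by (intro power_mono) (auto simp: e_def algebra_simps)
    ultimately have "(cmod (ip e s))\<^sup>2 / g \<le> 0"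
      by simp
    then show ?thesis
      using g by (simp add: divide_le_0_iff e_def)
  qed
  with v that show ?thesis by blast
qed

text \<open>The kernel of \<open>l\<close> is closed by the bound. Its orthogonal complement is the
  line through \<open>e\<close>, the part of a vector \<open>h\<close> with
  \<open>l h \<noteq> 0\<close> that is orthogonal to the kernel; \<open>u\<close> is the multiple
  of \<open>e\<close> with \<open>ip e u = l e\<close>.\<close>

lemma riesz_representation:
  assumes add: "\<And>F G. F \<in> R \<Longrightarrow> G \<in> R \<Longrightarrow> l (F + G) = l F + l G"
    and smult: "\<And>c F. F \<in> R \<Longrightarrow> l (smult_f c F) = c * l F"
    and bound: "\<And>F. F \<in> R \<Longrightarrow> cmod (l F) \<le> C * nrm ip F"
  obtains u where "u \<in> R" "\<And>F. F \<in> R \<Longrightarrow> ip F u = l F"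
proof (cases "\<exists>h\<in>R. l h \<noteq> 0")
  case False
  then show ?thesis
    using that[of 0] ip_zero ip_cnj[of 0] by simp
next
  case True
  then obtain h where h: "h \<in> R" "l h \<noteq> 0" by blast
  have diff: "l (F - G) = l F - l G" if "F \<in> R" "G \<in> R" for F G
    using that by (simp add: diff_as_add add smult)
  have l0: "l 0 = 0"
    using diff[of 0 0] by simp
  have "closed_subspace {F \<in> R. l F = 0}"
    unfolding closed_subspace_def
  proof (intro conjI allI impI)
    fix X F assume X: "\<forall>i::nat. X i \<in> {F \<in> R. l F = 0}" and F: "F \<in> R"
      and lim: "(\<lambda>i. nrm ip (X i - F)) \<longlonglongrightarrow> 0"
    have "cmod (l F) \<le> C * nrm ip (X i - F)" for i
      using bound[of "X i - F"] X F by (simp add: diff)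
    moreover have "(\<lambda>i. C * nrm ip (X i - F)) \<longlonglongrightarrow> C * 0"
      by (intro tendsto_mult tendsto_const lim)
    ultimately have "cmod (l F) \<le> C * 0"
      by (intro LIMSEQ_le_const) auto
    then show "F \<in> {F \<in> R. l F = 0}" using F by simp
  qed (auto simp: add smult l0)
  then obtain v where "v \<in> {F \<in> R. l F = 0}"
    and orth: "\<And>s. s \<in> {F \<in> R. l F = 0} \<Longrightarrow> ip (h - v) s = 0"
    using projection_exists[OF _ h(1)] by blast
  then have v: "v \<in> R" "l v = 0"
    by simp_all
  define e where "e = h - v"
  have e: "e \<in> R" "l e = l h" using h v by (auto simp: e_def diff)
  have "e \<noteq> 0" using e h l0 by auto
  then have n: "ip e e \<noteq> 0" using ip_self_eq_0 e by blast
  define u where "u = smult_f (cnj (l e / ip e e)) e"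
  show ?thesis
  proof
    show "u \<in> R" using e by (simp add: u_def)
    fix F assume F: "F \<in> R"
    \<comment> \<open>Every \<open>F\<close> splits into a multiple of \<open>e\<close> and an
      element of the kernel, so it is enough to test the formula on \<open>e\<close>.\<close>
    have "l (F - smult_f (l F / l e) e) = 0"
      using F e h by (simp add: diff smult)
    then have "ip (F - smult_f (l F / l e) e) e = 0"
      using orth[of "F - smult_f (l F / l e) e"] F e ip_cnj[of e "F - smult_f (l F / l e) e"]
      by (simp add: e_def)
    then have "ip F e = l F / l e * ip e e"
      using F e by (simp add: ip_diff ip_smult)
    then show "ip F u = l F"
      using F e h n by (simp add: u_def ip_smult_right)
  qed
qed

lemma lincomb_mem: "finite K \<Longrightarrow> (\<And>k. k \<in> K \<Longrightarrow> g k \<in> R) \<Longrightarrow> (\<lambda>w. \<Sum>k\<in>K. c k *s g k w) \<in> R"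
proof (induction K rule: finite_induct)
  case empty
  then show ?case
    using zero_mem by (simp add: zero_fun_def)
next
  case (insert a K)
  have "(\<lambda>w. \<Sum>k\<in>insert a K. c k *s g k w) = smult_f (c a) (g a) + (\<lambda>w. \<Sum>k\<in>K. c k *s g k w)"
    using insert by (simp add: fun_eq_iff smult_f_def)
  then show ?case
    using insert by simp
qed

lemma ip_lincomb_right:
  "finite K \<Longrightarrow> (\<And>k. k \<in> K \<Longrightarrow> g k \<in> R) \<Longrightarrow> h \<in> R \<Longrightarrow>
     ip h (\<lambda>w. \<Sum>k\<in>K. c k *s g k w) = (\<Sum>k\<in>K. cnj (c k) * ip h (g k))"
proof (induction K rule: finite_induct)
  case empty
  then show ?case
    using ip_cnj[OF zero_mem, of h] ip_zero[of h] by (simp add: zero_fun_def)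
next
  case (insert a K)
  have "(\<lambda>w. \<Sum>k\<in>insert a K. c k *s g k w) = smult_f (c a) (g a) + (\<lambda>w. \<Sum>k\<in>K. c k *s g k w)"
    using insert by (simp add: fun_eq_iff smult_f_def)
  moreover have "(\<lambda>w. \<Sum>k\<in>K. c k *s g k w) \<in> R"
    using insert by (intro lincomb_mem) auto
  ultimately show ?case
    using insert by (simp add: ip_add_right ip_smult_right)
qed

end

section \<open>Functions holomorphic along complex lines\<close>

text \<open>The constant depends only on \<open>M\<close> and \<open>r\<close>, so for a family of
  functions with a common bound the error is uniform in the parameter. The 8 is 2! divided by the
  square of 1/2: Cauchy's estimate is applied on discs of radius \<open>r / 2\<close>, which stay
  inside \<open>ball x (2 * r)\<close>.\<close>

lemma taylor_first_order_bound:
  fixes k :: "complex \<Rightarrow> complex"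
  assumes hol: "k holomorphic_on ball x (2 * r)" and r: "r > 0"
    and M: "\<And>z. z \<in> ball x (2 * r) \<Longrightarrow> cmod (k z) \<le> M" and z: "z \<in> ball x r"
  shows "cmod (k z - k x - deriv k x * (z - x)) \<le> 8 * M / r\<^sup>2 * (cmod (z - x))\<^sup>2"
proof -
  have "cmod ((deriv ^^ 2) k y) \<le> fact 2 * M / (r / 2) ^ 2" if y: "y \<in> ball x r" for y
  proof (rule Cauchy_inequality)
    have sub: "cball y (r / 2) \<subseteq> ball x (2 * r)"
      using y r by (auto simp: cball_subset_ball_iff dist_commute)
    show "k holomorphic_on ball y (r / 2)"
      by (rule holomorphic_on_subset[OF hol]) (use sub ball_subset_cball in blast)
    show "continuous_on (cball y (r / 2)) k"
      using holomorphic_on_imp_continuous_on[OF hol] sub continuous_on_subset by blast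
    show "cmod (k v) \<le> M" if "cmod (y - v) = r / 2" for v
      using sub that by (intro M) (auto simp: subset_iff dist_norm)
  qed (use r in simp)
  moreover have "((deriv ^^ i) k has_field_derivative (deriv ^^ Suc i) k y) (at y within ball x r)"
    if "y \<in> ball x r" for i y
  proof -
    have "(deriv ^^ i) k holomorphic_on ball x (2 * r)"
      by (intro holomorphic_higher_deriv hol) auto
    then have "((deriv ^^ i) k has_field_derivative deriv ((deriv ^^ i) k) y) (at y)"
      using that r by (intro holomorphic_derivI) auto
    then show ?thesis
      by (simp add: has_field_derivative_at_within)
  qed
  ultimately have "cmod ((deriv ^^ 0) k z - (\<Sum>i\<le>1. (deriv ^^ i) k x * (z - x) ^ i / fact i))
      \<le> fact 2 * M / (r / 2) ^ 2 * cmod (z - x) ^ Suc 1 / fact 1"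
    using r z by (intro complex_Taylor[of "ball x r"]) (auto simp: numeral_2_eq_2)
  then show ?thesis
    using r by (simp add: power2_eq_square algebra_simps)
qed

text \<open>Osgood's lemma, restricted to the diagonal.\<close>

lemma separately_holomorphic_diagonal:
  fixes h :: "complex \<Rightarrow> complex \<Rightarrow> complex"
  assumes S: "open S"
    and hol1: "\<And>m. m \<in> S \<Longrightarrow> (\<lambda>l. h l m) holomorphic_on S"
    and hol2: "\<And>l. l \<in> S \<Longrightarrow> h l holomorphic_on S"
    and bound: "\<And>x. x \<in> S \<Longrightarrow>
      \<exists>r>0. \<exists>M. \<forall>l\<in>ball x r \<inter> S. \<forall>m\<in>ball x r \<inter> S. cmod (h l m) \<le> M"
  shows "(\<lambda>l. h l l) holomorphic_on S"
  unfolding holomorphic_on_open[OF S]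
proof
  fix x assume x: "x \<in> S"
  obtain r1 where r1: "r1 > 0" "ball x r1 \<subseteq> S"
    using S x openE by blast
  obtain r2 M where r2: "r2 > 0"
    and M: "\<And>l m. l \<in> ball x r2 \<inter> S \<Longrightarrow> m \<in> ball x r2 \<inter> S \<Longrightarrow> cmod (h l m) \<le> M"
    using bound[OF x] by blast
  define r where "r = min r1 r2 / 2"
  define C where "C = 8 * M / r\<^sup>2"
  have r: "r > 0" and subS: "ball x (2 * r) \<subseteq> S" and sub2: "ball x (2 * r) \<subseteq> ball x r2 \<inter> S"
    using r1 r2 by (auto simp: r_def)
  \<comment> \<open>The partial derivative in the first variable at \<open>x\<close>, as a function
    of the second. All that is needed of it is continuity at \<open>x\<close>, obtained below from
    holomorphy.\<close>
  define D where "D = (\<lambda>m. deriv (\<lambda>l. h l m) x)"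
  have taylor: "cmod (h l m - h x m - D m * (l - x)) \<le> C * (cmod (l - x))\<^sup>2"
    if "l \<in> ball x r" "m \<in> ball x r" for l m
    unfolding D_def C_def
  proof (rule taylor_first_order_bound[OF _ r _ that(1)])
    have m: "m \<in> ball x (2 * r)" using that(2) r by auto
    show "(\<lambda>l. h l m) holomorphic_on ball x (2 * r)"
      using hol1[of m] m subS holomorphic_on_subset by blast
    show "cmod (h z m) \<le> M" if "z \<in> ball x (2 * r)" for z
      using M[of z m] that m sub2 by blast
  qed
  have quotient: "cmod ((h l m - h x m) / (l - x) - D m) \<le> C * cmod (l - x)"
    if "l \<in> ball x r" "m \<in> ball x r" "l \<noteq> x" for l m
  proof -
    have "(h l m - h x m) / (l - x) - D m = (h l m - h x m - D m * (l - x)) / (l - x)"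
      using that(3) by (simp add: field_simps)
    then show ?thesis
      using taylor[OF that(1,2)] that(3)
      by (simp add: norm_divide divide_le_eq power2_eq_square mult.assoc)
  qed
  \<comment> \<open>Increments tending to 0; the shift by 2 keeps \<open>x + s n\<close> strictly
    inside \<open>ball x r\<close> from \<open>n = 0\<close> on. The difference quotients with these
    increments are holomorphic in \<open>m\<close> and converge to \<open>D\<close>
    uniformly.\<close>
  define s where "s = (\<lambda>n. complex_of_real (r / real (n + 2)))"
  have s: "s n \<noteq> 0" "cmod (s n) < r" for n
    unfolding s_def norm_of_real using r by (simp_all add: field_simps flip: of_nat_Suc of_nat_add)
  have s_lim: "(\<lambda>n. C * cmod (s n)) \<longlonglongrightarrow> 0"
    unfolding s_def norm_of_real using r by real_asymp
  have "D holomorphic_on ball x r"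
  proof (rule holomorphic_uniform_sequence[where f = "\<lambda>n m. (h (x + s n) m - h x m) / s n"])
    show "(\<lambda>m. (h (x + s n) m - h x m) / s n) holomorphic_on ball x r" for n
    proof -
      have "x + s n \<in> S" and sub: "ball x r \<subseteq> S"
        using subS s[of n] r by (auto simp: subset_iff dist_norm)
      then show ?thesis
        using s(1)[of n] x by (intro holomorphic_intros holomorphic_on_subset[OF hol2 sub]) auto
    qed
    have lim: "uniform_limit (ball x r) (\<lambda>n m. (h (x + s n) m - h x m) / s n) D sequentially"
      unfolding uniform_limit_iff
    proof (intro allI impI)
      fix e :: real assume "e > 0"
      then have "\<forall>\<^sub>F n in sequentially. C * cmod (s n) < e"
        using order_tendstoD(2)[OF s_lim] by blast
      then show "\<forall>\<^sub>F n in sequentially. \<forall>m\<in>ball x r. dist ((h (x + s n) m - h x m) / s n) (D m) < e"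
      proof eventually_elim
        case (elim n)
        have "x + s n \<in> ball x r" "x + s n \<noteq> x"
          using s[of n] by (auto simp: dist_norm)
        then show ?case
          using quotient[of "x + s n"] elim by (fastforce simp: dist_norm intro: le_less_trans)
      qed
    qed
    show "\<exists>d>0. cball y d \<subseteq> ball x r \<and>
        uniform_limit (cball y d) (\<lambda>n m. (h (x + s n) m - h x m) / s n) D sequentially"
      if "y \<in> ball x r" for y
    proof -
      obtain d where "d > 0" "cball y d \<subseteq> ball x r"
        using open_contains_cball[of "ball x r"] \<open>y \<in> ball x r\<close> open_ball by blast
      then show ?thesis
        using uniform_limit_on_subset[OF lim] by blast
    qed
  qed auto
  then have D_lim: "(D \<longlongrightarrow> D x) (at x)"
    using r by (meson centre_in_ball continuous_on_eq_continuous_at holomorphic_on_imp_continuous_on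
        isCont_def open_ball)
  \<comment> \<open>The increment on the diagonal is split at \<open>h x l\<close>. In the first
    part the second variable moves too, which is where uniformity in \<open>m\<close> and continuity
    of \<open>D\<close> enter; the second part is an ordinary derivative.\<close>
  have "((\<lambda>l. (h l l - h x l) / (l - x) - D l) \<longlongrightarrow> 0) (at x)"
  proof (rule Lim_null_comparison)
    have "\<forall>\<^sub>F l in at x. l \<in> ball x r"
      using r by (intro eventually_at_in_open') auto
    moreover have "\<forall>\<^sub>F l in at x. l \<noteq> x"
      by (simp add: eventually_at_filter)
    ultimately show "\<forall>\<^sub>F l in at x. cmod ((h l l - h x l) / (l - x) - D l) \<le> C * cmod (l - x)"
      by eventually_elim (use quotient in auto)
    show "((\<lambda>l. C * cmod (l - x)) \<longlongrightarrow> 0) (at x)"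
      by (rule tendsto_eq_intros refl | simp)+
  qed
  from tendsto_add[OF this D_lim]
  have first: "((\<lambda>l. (h l l - h x l) / (l - x)) \<longlongrightarrow> D x) (at x)"
    by simp
  obtain E where "(h x has_field_derivative E) (at x)"
    using hol2[OF x] x S by (auto simp: holomorphic_on_open)
  then have "((\<lambda>l. (h x l - h x x) / (l - x)) \<longlongrightarrow> E) (at x)"
    by (simp add: has_field_derivative_iff)
  from tendsto_add[OF first this]
  have "((\<lambda>l. (h l l - h x x) / (l - x)) \<longlongrightarrow> D x + E) (at x)"
    by (simp add: add_divide_distrib[symmetric])
  then show "\<exists>f'. ((\<lambda>l. h l l) has_field_derivative f') (at x)"
    by (auto simp: has_field_derivative_iff)
qed

section \<open>Holomorphy and local boundedness along lines\<close>

definition line_preimage :: "(complex^'n) set \<Rightarrow> complex^'n \<Rightarrow> complex^'n \<Rightarrow> complex set" where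
  "line_preimage \<Omega> a b = {t. a + t *s b \<in> \<Omega>}"

definition line_holomorphic :: "(complex^'n) set \<Rightarrow> (complex^'n \<Rightarrow> complex) \<Rightarrow> bool" where
  "line_holomorphic \<Omega> g \<longleftrightarrow> (\<forall>a b. (\<lambda>t. g (a + t *s b)) holomorphic_on line_preimage \<Omega> a b)"

text \<open>The bound is local on each line separately, not local in \<open>\<Omega>\<close>:
  holomorphy along lines gives continuity, hence local bounds, only on the lines themselves.\<close>

definition line_bounded :: "(complex^'n) set \<Rightarrow> (complex^'n \<Rightarrow> real) \<Rightarrow> bool" where
  "line_bounded \<Omega> N \<longleftrightarrow> (\<forall>a b. \<forall>t\<in>line_preimage \<Omega> a b.
     \<exists>r>0. \<exists>M. \<forall>s\<in>ball t r \<inter> line_preimage \<Omega> a b. N (a + s *s b) \<le> M)"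

lemma in_line_preimage [simp]: "t \<in> line_preimage \<Omega> a b \<longleftrightarrow> a + t *s b \<in> \<Omega>"
  by (simp add: line_preimage_def)

lemma continuous_line [continuous_intros]: "continuous_on S (\<lambda>t. a + t *s (b :: complex^'n))"
  unfolding vector_scalar_mult_def by (intro continuous_intros continuous_on_vec_lambda)

lemma open_line_preimage:
  fixes a :: "complex^'n"
  assumes "open \<Omega>" shows "open (line_preimage \<Omega> a b)"
  using open_vimage[OF assms continuous_line[of UNIV a b]]
  by (simp add: line_preimage_def vimage_def)

lemma convex_line_preimage:
  fixes a :: "complex^'n"
  assumes "convex \<Omega>" shows "convex (line_preimage \<Omega> a b)"
proof (rule convexI)
  fix s t and u v :: real
  assume "s \<in> line_preimage \<Omega> a b" "t \<in> line_preimage \<Omega> a b" and uv: "0 \<le> u" "0 \<le> v" "u + v = 1"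
  then have "u *\<^sub>R (a + s *s b) + v *\<^sub>R (a + t *s b) \<in> \<Omega>"
    using convexD[OF assms] by simp
  moreover have affine: "complex_of_real u * c + of_real v * c = c" for c
    using uv(3) by (metis distrib_right mult_1 of_real_1 of_real_add)
  have "u *\<^sub>R (a + s *s b) + v *\<^sub>R (a + t *s b) = a + (u *\<^sub>R s + v *\<^sub>R t) *s b"
    by (simp add: vec_eq_iff scaleR_conv_of_real[where 'a = complex] algebra_simps)
      (simp add: affine)
  ultimately show "u *\<^sub>R s + v *\<^sub>R t \<in> line_preimage \<Omega> a b"
    by simp
qed

lemma line_holomorphicD:
  "line_holomorphic \<Omega> g \<Longrightarrow> (\<lambda>t. g (a + t *s b)) holomorphic_on line_preimage \<Omega> a b"
  by (simp add: line_holomorphic_def)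

lemma line_holomorphic_subset: "line_holomorphic \<Omega> g \<Longrightarrow> B \<subseteq> \<Omega> \<Longrightarrow> line_holomorphic B g"
  unfolding line_holomorphic_def by (meson holomorphic_on_subset in_line_preimage subsetD subsetI)

lemma line_holomorphic_diff:
  "line_holomorphic \<Omega> f \<Longrightarrow> line_holomorphic \<Omega> g \<Longrightarrow> line_holomorphic \<Omega> (\<lambda>z. f z - g z)"
  unfolding line_holomorphic_def by (intro allI holomorphic_intros) auto

lemma line_holomorphic_mult:
  "line_holomorphic \<Omega> f \<Longrightarrow> line_holomorphic \<Omega> g \<Longrightarrow> line_holomorphic \<Omega> (\<lambda>z. f z * g z)"
  unfolding line_holomorphic_def by (intro allI holomorphic_intros) auto

lemma line_holomorphic_divide:
  "line_holomorphic \<Omega> f \<Longrightarrow> line_holomorphic \<Omega> g \<Longrightarrow> (\<And>z. z \<in> \<Omega> \<Longrightarrow> g z \<noteq> 0) \<Longrightarrow>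
     line_holomorphic \<Omega> (\<lambda>z. f z / g z)"
  unfolding line_holomorphic_def by (intro allI holomorphic_intros) auto

lemma line_holomorphic_sum:
  "(\<And>i. i \<in> I \<Longrightarrow> line_holomorphic \<Omega> (f i)) \<Longrightarrow> line_holomorphic \<Omega> (\<lambda>z. \<Sum>i\<in>I. f i z)"
  unfolding line_holomorphic_def by (intro allI holomorphic_intros) auto

lemma line_holomorphic_prod:
  "(\<And>i. i \<in> I \<Longrightarrow> line_holomorphic \<Omega> (f i)) \<Longrightarrow> line_holomorphic \<Omega> (\<lambda>z. \<Prod>i\<in>I. f i z)"
  unfolding line_holomorphic_def by (intro allI holomorphic_intros) auto

lemma line_holomorphic_const: "line_holomorphic \<Omega> (\<lambda>z. c)"
  unfolding line_holomorphic_def by (intro allI holomorphic_intros)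

lemma line_holomorphic_det:
  fixes A :: "complex^'n \<Rightarrow> complex^'m^'m"
  assumes "\<And>i j. line_holomorphic \<Omega> (\<lambda>z. A z $ i $ j)"
  shows "line_holomorphic \<Omega> (\<lambda>z. det (A z))"
  unfolding det_def
  by (intro line_holomorphic_sum line_holomorphic_mult line_holomorphic_prod line_holomorphic_const assms)

lemma line_holomorphic_cong:
  "(\<And>z. z \<in> \<Omega> \<Longrightarrow> f z = g z) \<Longrightarrow> line_holomorphic \<Omega> f \<longleftrightarrow> line_holomorphic \<Omega> g"
  unfolding line_holomorphic_def
  by (intro all_cong1 holomorphic_cong) auto

text \<open>Small discs of each line lie in balls where convergence is uniform, so the one-variable
  theorem of Weierstrass applies. Both passages to a limit, in the sup norm for A(Omega) and in the
  norm of R, go through this lemma.\<close>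

lemma line_holomorphic_uniform_limit:
  fixes g :: "complex^'n \<Rightarrow> complex"
  assumes \<Omega>: "open \<Omega>" and hol: "\<And>k::nat. line_holomorphic \<Omega> (f k)"
    and lim: "\<And>z. z \<in> \<Omega> \<Longrightarrow> \<exists>r>0. uniform_limit (\<Omega> \<inter> ball z r) f g sequentially"
  shows "line_holomorphic \<Omega> g"
  unfolding line_holomorphic_def
proof (intro allI)
  fix a b :: "complex^'n"
  show "(\<lambda>t. g (a + t *s b)) holomorphic_on line_preimage \<Omega> a b"
  proof (rule holomorphic_uniform_sequence[OF open_line_preimage[OF \<Omega>] line_holomorphicD[OF hol]])
    fix t assume t: "t \<in> line_preimage \<Omega> a b"
    then obtain r where r: "r > 0" "uniform_limit (\<Omega> \<inter> ball (a + t *s b) r) f g sequentially"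
      using lim by auto
    have "open (line_preimage (\<Omega> \<inter> ball (a + t *s b) r) a b)"
      by (intro open_line_preimage open_Int \<Omega> open_ball)
    then obtain d where d: "d > 0" "cball t d \<subseteq> line_preimage (\<Omega> \<inter> ball (a + t *s b) r) a b"
      using t r by (metis IntI centre_in_ball in_line_preimage open_contains_cball)
    then have "uniform_limit (cball t d) (\<lambda>k s. f k (a + s *s b)) (\<lambda>s. g (a + s *s b)) sequentially"
      using r(2) unfolding uniform_limit_iff
      by (elim all_forward imp_forward eventually_mono) (auto simp: subset_iff)
    then show "\<exists>d>0. cball t d \<subseteq> line_preimage \<Omega> a b \<and>
        uniform_limit (cball t d) (\<lambda>k s. f k (a + s *s b)) (\<lambda>s. g (a + s *s b)) sequentially"
      using d by (intro exI[of _ d]) (auto simp: subset_iff)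
  qed
qed

text \<open>By the chain rule the derivative along the line is \<open>L\<close> applied to multiples
  of \<open>b\<close>; homogeneity of \<open>L\<close> over the complex numbers turns this into
  multiplication by the single number \<open>L b\<close>.\<close>

lemma holo_on_imp_line_holomorphic:
  assumes hol: "holo_on U g" and U: "open U"
  shows "line_holomorphic U g"
  unfolding line_holomorphic_def holomorphic_on_open[OF open_line_preimage[OF U]]
proof (intro allI ballI)
  fix a b and t assume "t \<in> line_preimage U a b"
  then obtain L where L: "(g has_derivative L) (at (a + t *s b))"
    and lin: "\<And>c v. L (c *s v) = c * L v"
    using hol by (auto simp: holo_on_def)
  have "linear (\<lambda>s. s *s b)"
    by (auto intro!: linearI simp: vec_eq_iff algebra_simps)
  then have "((\<lambda>s. a + s *s b) has_derivative (\<lambda>s. s *s b)) (at t)"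
    using has_derivative_add[OF has_derivative_const bounded_linear_imp_has_derivative]
    by (fastforce simp: linear_conv_bounded_linear)
  from has_derivative_compose[OF this L]
  have "((\<lambda>s. g (a + s *s b)) has_field_derivative L b) (at t)"
    by (simp add: lin has_field_derivative_def mult_commute_abs)
  then show "\<exists>f'. ((\<lambda>s. g (a + s *s b)) has_field_derivative f') (at t)"
    by blast
qed

lemma A_alg_line_holomorphic:
  assumes \<Omega>: "open \<Omega>" and \<phi>: "\<phi> \<in> A_alg \<Omega>"
  shows "line_holomorphic \<Omega> \<phi>"
proof -
  have "\<exists>g. line_holomorphic \<Omega> g \<and> (\<forall>z\<in>\<Omega>. cmod (\<phi> z - g z) < 1 / real (Suc k))" for k
  proof -
    have "1 / real (Suc k) > 0" by simp
    then obtain U g where "open U" "closure \<Omega> \<subseteq> U" "holo_on U g"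
      and close: "\<forall>z\<in>\<Omega>. cmod (\<phi> z - g z) < 1 / real (Suc k)"
      using \<phi> unfolding A_alg_def by blast
    then have "line_holomorphic \<Omega> g"
      using closure_subset[of \<Omega>] holo_on_imp_line_holomorphic line_holomorphic_subset by blast
    with close show ?thesis by blast
  qed
  then obtain g where g: "\<And>k. line_holomorphic \<Omega> (g k)"
    and close: "\<And>k z. z \<in> \<Omega> \<Longrightarrow> cmod (\<phi> z - g k z) < 1 / real (Suc k)"
    by metis
  have "uniform_limit \<Omega> g \<phi> sequentially"
    unfolding uniform_limit_iff
  proof (intro allI impI)
    fix e :: real assume "e > 0"
    then have "\<forall>\<^sub>F k in sequentially. 1 / real (Suc k) < e"
      using order_tendstoD(2)[OF LIMSEQ_Suc[OF lim_1_over_n]] by simp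
    then show "\<forall>\<^sub>F k in sequentially. \<forall>z\<in>\<Omega>. dist (g k z) (\<phi> z) < e"
      by eventually_elim (use close in \<open>force simp: dist_norm norm_minus_commute intro: less_trans\<close>)
  qed
  then show ?thesis
    by (intro line_holomorphic_uniform_limit[OF \<Omega> g] exI[of _ 1])
       (auto intro: uniform_limit_on_subset)
qed

lemma line_holomorphic_imp_line_bounded:
  fixes g :: "complex^'n \<Rightarrow> complex"
  assumes "open \<Omega>" and "line_holomorphic \<Omega> g"
  shows "line_bounded \<Omega> (\<lambda>z. cmod (g z))"
  unfolding line_bounded_def
proof (intro allI ballI)
  fix a b t assume t: "t \<in> line_preimage \<Omega> a b"
  have "continuous_on (line_preimage \<Omega> a b) (\<lambda>s. g (a + s *s b))"
    using assms(2) by (intro holomorphic_on_imp_continuous_on line_holomorphicD)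
  then obtain r where r: "r > 0"
    and close: "\<And>s. s \<in> line_preimage \<Omega> a b \<Longrightarrow> dist s t < r \<Longrightarrow> dist (g (a + s *s b)) (g (a + t *s b)) < 1"
    using t unfolding continuous_on_iff by (metis zero_less_one)
  have "cmod (g (a + s *s b)) \<le> cmod (g (a + t *s b)) + 1" if "s \<in> ball t r \<inter> line_preimage \<Omega> a b" for s
    using close[of s] that norm_triangle_ineq2[of "g (a + s *s b)" "g (a + t *s b)"]
    by (simp add: dist_norm dist_commute norm_minus_commute)
  then show "\<exists>r>0. \<exists>M. \<forall>s\<in>ball t r \<inter> line_preimage \<Omega> a b. cmod (g (a + s *s b)) \<le> M"
    using r by blast
qed

lemma line_bounded_add:
  fixes M N :: "complex^'n \<Rightarrow> real"
  assumes "line_bounded \<Omega> M" and "line_bounded \<Omega> N"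
  shows "line_bounded \<Omega> (\<lambda>z. M z + N z)"
  unfolding line_bounded_def
proof (intro allI ballI)
  fix a b t assume t: "t \<in> line_preimage \<Omega> a b"
  obtain r1 C1 where 1: "r1 > 0" "\<And>s. s \<in> ball t r1 \<inter> line_preimage \<Omega> a b \<Longrightarrow> M (a + s *s b) \<le> C1"
    using assms(1) t unfolding line_bounded_def by blast
  obtain r2 C2 where 2: "r2 > 0" "\<And>s. s \<in> ball t r2 \<inter> line_preimage \<Omega> a b \<Longrightarrow> N (a + s *s b) \<le> C2"
    using assms(2) t unfolding line_bounded_def by blast
  show "\<exists>r>0. \<exists>C. \<forall>s\<in>ball t r \<inter> line_preimage \<Omega> a b. M (a + s *s b) + N (a + s *s b) \<le> C"
    using 1 2 by (intro exI[of _ "min r1 r2"] conjI exI[of _ "C1 + C2"]) (auto intro!: add_mono)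
qed

lemma line_bounded_sum:
  "finite I \<Longrightarrow> (\<And>i. i \<in> I \<Longrightarrow> line_bounded \<Omega> (N i)) \<Longrightarrow> line_bounded \<Omega> (\<lambda>z. \<Sum>i\<in>I. N i z)"
proof (induction I rule: finite_induct)
  case empty
  show ?case
    unfolding line_bounded_def by (auto intro!: exI[of _ 1])
next
  case (insert i I)
  then show ?case
    by (simp add: line_bounded_add)
qed

lemma line_bounded_subset:
  assumes "line_bounded \<Omega> N" and "B \<subseteq> \<Omega>"
  shows "line_bounded B N"
  unfolding line_bounded_def
proof (intro allI ballI)
  fix a b t assume "t \<in> line_preimage B a b"
  then have "t \<in> line_preimage \<Omega> a b"
    using assms(2) by auto
  then obtain r M where "r > 0" "\<forall>s\<in>ball t r \<inter> line_preimage \<Omega> a b. N (a + s *s b) \<le> M"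
    using assms(1) unfolding line_bounded_def by blast
  then show "\<exists>r>0. \<exists>M. \<forall>s\<in>ball t r \<inter> line_preimage B a b. N (a + s *s b) \<le> M"
    using assms(2) by (intro exI[of _ r] conjI exI[of _ M]) auto
qed

text \<open>Inside a ball contained in \<open>\<Omega>\<close>, vanishing spreads from a
  neighbourhood of one point to every other point along the line joining them. Connectedness of
  \<open>\<Omega>\<close> does the rest.\<close>

lemma line_identity_theorem:
  fixes g :: "complex^'n \<Rightarrow> complex"
  assumes \<Omega>: "open \<Omega>" "connected \<Omega>" and hol: "line_holomorphic \<Omega> g"
    and B: "r > 0" "ball c r \<subseteq> \<Omega>" and zero: "\<And>z. z \<in> ball c r \<Longrightarrow> g z = 0" and z: "z \<in> \<Omega>"
  shows "g z = 0"
proof -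
  define Z where "Z = {z \<in> \<Omega>. \<exists>e>0. ball z e \<subseteq> \<Omega> \<and> (\<forall>p\<in>ball z e. g p = 0)}"
  \<comment> \<open>The single fact behind both openness and closedness of \<open>Z\<close>: one
    point of \<open>Z\<close> in a ball inside \<open>\<Omega>\<close> puts the centre into
    \<open>Z\<close>.\<close>
  have extend: "p \<in> Z" if p: "ball p e \<subseteq> \<Omega>" "e > 0" and q: "q \<in> Z" "q \<in> ball p e" for p q e
  proof -
    obtain d where d: "d > 0" "\<And>y. y \<in> ball q d \<Longrightarrow> g y = 0"
      using q by (auto simp: Z_def)
    have "g y = 0" if y: "y \<in> ball p e" for y
    proof -
      define S where "S = line_preimage (ball p e) q (y - q)"
      have S: "open S" "convex S"
        unfolding S_def by (intro open_line_preimage convex_line_preimage open_ball convex_ball)+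
      have "open (line_preimage (ball q d \<inter> ball p e) q (y - q))"
        by (intro open_line_preimage) auto
      \<comment> \<open>On the line through \<open>q\<close> and \<open>y\<close>, zeros near
        parameter 0 propagate to parameter 1; the part of the line inside the ball is convex, hence
        connected.\<close>
      then have "g (q + 1 *s (y - q)) = 0"
      proof (rule analytic_continuation_open[where s' = S and g = "\<lambda>_. 0" and z = 1
            and f = "\<lambda>t. g (q + t *s (y - q))"])
        show "(\<lambda>t. g (q + t *s (y - q))) holomorphic_on S"
          unfolding S_def using line_holomorphic_subset[OF hol p(1)] by (rule line_holomorphicD)
        show "line_preimage (ball q d \<inter> ball p e) q (y - q) \<noteq> {}"
          using d q by (auto intro!: exI[of _ 0] simp: set_eq_iff line_preimage_def)
      qed (use S d y in \<open>auto simp: S_def convex_connected\<close>)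
      then show ?thesis by simp
    qed
    then show ?thesis
      using p by (auto simp: Z_def)
  qed
  have "openin (top_of_set \<Omega>) Z"
  proof -
    have "open Z"
      unfolding open_contains_ball
    proof
      fix p assume p: "p \<in> Z"
      then obtain e where e: "e > 0" "ball p e \<subseteq> \<Omega>" by (auto simp: Z_def)
      have "q \<in> Z" if q: "q \<in> ball p (e / 2)" for q
      proof (rule extend[of q "e / 2" p])
        show "ball q (e / 2) \<subseteq> \<Omega>"
          using q by (intro order_trans[OF _ e(2)]) (auto simp: ball_subset_ball_iff dist_commute)
      qed (use p q e in \<open>auto simp: dist_commute\<close>)
      then show "\<exists>e>0. ball p e \<subseteq> Z"
        using e by (intro exI[of _ "e / 2"]) auto
    qed
    then show ?thesis
      using \<Omega>(1) by (auto simp: openin_open_eq Z_def)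
  qed
  moreover have "closedin (top_of_set \<Omega>) Z"
    unfolding closedin_limpt
  proof (intro conjI allI impI)
    fix p assume p: "p islimpt Z \<and> p \<in> \<Omega>"
    then obtain e where e: "e > 0" "ball p e \<subseteq> \<Omega>"
      using \<Omega>(1) openE by blast
    then obtain q where "q \<in> Z" "q \<in> ball p e"
      using p islimpt_approachable[of p Z] by (auto simp: dist_commute)
    then show "p \<in> Z"
      using extend e by blast
  qed (auto simp: Z_def)
  moreover have "c \<in> Z"
    using B zero by (auto simp: Z_def)
  ultimately have "Z = \<Omega>"
    using \<Omega>(2) unfolding connected_clopen by blast
  then have "z \<in> Z"
    using z by simp
  then obtain e where "e > 0" "\<forall>p\<in>ball z e. g p = 0"
    unfolding Z_def by blast
  then show ?thesis
    by simp
qed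

text \<open>With a = (p + q)/2 and b = (p - q)/(2i), the function mapping t to G (a + t b) (a + cnj t b) is
  holomorphic, vanishes for real t, and equals G p q at t = i.\<close>

lemma sesquiholomorphic_polarization:
  fixes G :: "complex^'n \<Rightarrow> complex^'n \<Rightarrow> complex"
  assumes B: "open B" "convex B"
    and hol1: "\<And>w. w \<in> B \<Longrightarrow> line_holomorphic B (\<lambda>z. G z w)"
    and hol2: "\<And>z. z \<in> B \<Longrightarrow> line_holomorphic B (\<lambda>w. cnj (G z w))"
    and N: "line_bounded B N" and bound: "\<And>z w. z \<in> B \<Longrightarrow> w \<in> B \<Longrightarrow> cmod (G z w) \<le> N z * N w"
    and N_nonneg: "\<And>z. z \<in> B \<Longrightarrow> 0 \<le> N z"
    and diag: "\<And>z. z \<in> B \<Longrightarrow> G z z = 0" and p: "p \<in> B" and q: "q \<in> B"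
  shows "G p q = 0"
proof -
  define a where "a = (1/2) *s (p + q)"
  define b where "b = (- \<i> / 2) *s (p - q)"
  have a: "a \<in> B"
    using convexD[OF B(2) p q, of "1/2" "1/2"]
    by (simp add: a_def vec_eq_iff vector_scalar_mult_def scaleR_vec_def scaleR_conv_of_real algebra_simps plus_vec_def)
  have ab: "a + \<i> *s b = p" "a + cnj \<i> *s b = q"
    by (simp_all add: a_def b_def vec_eq_iff field_simps)
  define T where "T = line_preimage B a b"
  \<comment> \<open>The conjugation-invariant part of the parameter set, on which both arguments of
    \<open>G\<close> stay in \<open>B\<close>. It is convex and contains 0 and \<open>\<i>\<close>,
    since these correspond to \<open>a\<close> and to the pair \<open>p\<close>,
    \<open>q\<close>.\<close>
  define S where "S = T \<inter> cnj -` T"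
  have T: "open T" "convex T"
    unfolding T_def by (intro open_line_preimage convex_line_preimage B)+
  have cT: "open (cnj -` T)" "convex (cnj -` T)"
    using T by (auto intro!: open_vimage convex_linear_vimage continuous_intros
        bounded_linear.linear[OF bounded_linear_cnj])
  have S: "open S" "convex S"
    unfolding S_def using T cT by (auto intro: convex_Int)
  have S_iff: "t \<in> S \<longleftrightarrow> a + t *s b \<in> B \<and> a + cnj t *s b \<in> B" for t
    by (simp add: S_def T_def)
  \<comment> \<open>The two arguments get independent parameters, and the conjugate on
    \<open>m\<close> turns antiholomorphy in the second argument into holomorphy.\<close>
  define h where "h = (\<lambda>l m. G (a + l *s b) (a + cnj m *s b))"
  have "(\<lambda>l. h l l) holomorphic_on S"
  proof (rule separately_holomorphic_diagonal[where h = h, OF S(1)])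
    show "(\<lambda>l. h l m) holomorphic_on S" if "m \<in> S" for m
      unfolding h_def using that S_iff
      by (intro holomorphic_on_subset[OF line_holomorphicD[OF hol1]]) auto
    show "h l holomorphic_on S" if "l \<in> S" for l
    proof -
      have "(\<lambda>s. cnj (G (a + l *s b) (a + s *s b))) holomorphic_on cnj ` S"
        using that S_iff by (intro holomorphic_on_subset[OF line_holomorphicD[OF hol2]]) auto
      from holomorphic_on_compose_cnj_cnj[OF this S(1)]
      show ?thesis
        by (simp add: h_def o_def)
    qed
    \<comment> \<open>The product form of the bound on \<open>G\<close> reduces a joint bound in
      \<open>l\<close> and \<open>m\<close> to bounds of \<open>N\<close> along one line, near
      \<open>x\<close> and near \<open>cnj x\<close>.\<close>
    show "\<exists>r>0. \<exists>M. \<forall>l\<in>ball x r \<inter> S. \<forall>m\<in>ball x r \<inter> S. cmod (h l m) \<le> M" if x: "x \<in> S" for x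
    proof -
      obtain r1 M1 where r1: "r1 > 0" "\<And>s. s \<in> ball x r1 \<inter> T \<Longrightarrow> N (a + s *s b) \<le> M1"
        using N x S_iff unfolding line_bounded_def T_def by (metis in_line_preimage)
      obtain r2 M2 where r2: "r2 > 0" "\<And>s. s \<in> ball (cnj x) r2 \<inter> T \<Longrightarrow> N (a + s *s b) \<le> M2"
        using N x S_iff unfolding line_bounded_def T_def by (metis in_line_preimage)
      have "cmod (h l m) \<le> M1 * M2"
        if l: "l \<in> ball x (min r1 r2) \<inter> S" and m: "m \<in> ball x (min r1 r2) \<inter> S" for l m
      proof -
        have "N (a + l *s b) \<le> M1"
          using l S_iff by (intro r1) (auto simp: T_def)
        moreover have "N (a + cnj m *s b) \<le> M2"
          using m S_iff by (intro r2) (auto simp: T_def dist_norm simp flip: complex_cnj_diff)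
        moreover have "0 \<le> N (a + l *s b)" "0 \<le> N (a + cnj m *s b)"
          "cmod (h l m) \<le> N (a + l *s b) * N (a + cnj m *s b)"
          using l m S_iff by (auto intro!: N_nonneg bound simp: h_def)
        ultimately show ?thesis
          by (meson mult_mono order_trans)
      qed
      then show ?thesis
        using r1(1) r2(1) by (intro exI[of _ "min r1 r2"] conjI exI[of _ "M1 * M2"]) auto
    qed
  qed
  moreover have "0 islimpt S \<inter> \<real>"
    unfolding islimpt_approachable
  proof (intro allI impI)
    fix e :: real assume e: "e > 0"
    have "0 \<in> S" using a S_iff by simp
    then obtain d where d: "d > 0" "ball 0 d \<subseteq> S"
      using S(1) openE by blast
    then have "of_real (min d e / 2) \<in> S \<inter> \<real>"
      using e by (auto simp: subset_iff)
    then show "\<exists>t\<in>S \<inter> \<real>. t \<noteq> 0 \<and> dist t 0 < e"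
      using d e by (intro bexI[of _ "of_real (min d e / 2)"]) auto
  qed
  moreover have "h t t = 0" if "t \<in> S \<inter> \<real>" for t
    using that S_iff[of t] by (auto simp: h_def Reals_cnj_iff intro!: diag)
  ultimately have "h \<i> \<i> = 0"
    using analytic_continuation[of "\<lambda>l. h l l" S "S \<inter> \<real>" 0 \<i>] S a p q ab S_iff[of 0] S_iff[of \<i>]
    by (auto simp: convex_connected)
  then show ?thesis
    using ab by (simp add: h_def)
qed

section \<open>The kernel of a quasi-free module in a generating frame\<close>

lemma fspanE:
  assumes "g \<in> fspan M"
  obtains K :: nat and c G where "\<And>k. k < K \<Longrightarrow> G k \<in> M" "g = (\<lambda>w. \<Sum>k<K. c k *s G k w)"
  using assms unfolding fspan_def mem_Collect_eq by metis

lemma matrix_vector_mult_axis: "(A *v axis l 1) $ k = (A :: complex^'m^'n) $ k $ l"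
  by (simp add: matrix_vector_mult_def axis_def if_distrib cong: if_cong)

lemma
  fixes A :: "'a::field^'n^'n"
  assumes "det A \<noteq> 0"
  shows matrix_inv_right: "A ** matrix_inv A = mat 1" and matrix_inv_left: "matrix_inv A ** A = mat 1"
  using someI_ex[of "\<lambda>B. A ** B = mat 1 \<and> B ** A = mat 1"] assms
  by (auto simp: matrix_inv_def invertible_def simp flip: invertible_det_nz)

text \<open>Cramer's rule exhibits the entries of the inverse as quotients of determinants, which is
  how holomorphy passes from a matrix to its inverse.\<close>

lemma matrix_inv_entry:
  fixes A :: "complex^'m^'m"
  assumes "det A \<noteq> 0"
  shows "matrix_inv A $ k $ l = det (\<chi> i j. if j = k then axis l 1 $ i else A $ i $ j) / det A"
proof -
  have "A ** matrix_inv A = mat 1"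
    using assms by (rule matrix_inv_right)
  then have "A *v (matrix_inv A *v axis l 1) = axis l 1"
    by (simp add: matrix_vector_mul_assoc)
  then have "(matrix_inv A *v axis l 1) $ k = det (\<chi> i j. if j = k then axis l 1 $ i else A $ i $ j) / det A"
    unfolding cramer[OF assms] by simp
  then show ?thesis
    by (simp add: matrix_vector_mult_axis)
qed

locale generated_module =
  fixes \<Omega> :: "(complex^'n::finite) set"
    and R :: "('n, 'm::finite) vfun set"
    and ip :: "('n, 'm) vfun \<Rightarrow> ('n, 'm) vfun \<Rightarrow> complex"
    and f :: "'m \<Rightarrow> ('n, 'm) vfun"
  assumes open_domain: "open \<Omega>"
    and quasi_free: "quasi_free \<Omega> R ip"
    and generating: "generating_set \<Omega> R ip f"
begin

sublocale hilbert_functions \<Omega> R ip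
  using quasi_free by unfold_locales (simp add: quasi_free_def)

lemma eval_bound:
  assumes "z \<in> \<Omega>"
  obtains r C where "r > 0" "\<And>w F. w \<in> \<Omega> \<inter> ball z r \<Longrightarrow> F \<in> R \<Longrightarrow> norm (F w) \<le> C * nrm ip F"
  using quasi_free assms unfolding quasi_free_def by metis

lemma eval_tendsto:
  assumes z: "z \<in> \<Omega>" and X: "\<And>i. X i \<in> R" and F: "F \<in> R" and lim: "(\<lambda>i. nrm ip (X i - F)) \<longlonglongrightarrow> 0"
  shows "(\<lambda>i. X i z) \<longlonglongrightarrow> F z"
proof -
  obtain r C where "r > 0" and C: "\<And>w F. w \<in> \<Omega> \<inter> ball z r \<Longrightarrow> F \<in> R \<Longrightarrow> norm (F w) \<le> C * nrm ip F"
    using eval_bound[OF z] by blast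
  have "(\<lambda>i. X i z - F z) \<longlonglongrightarrow> 0"
  proof (rule Lim_null_comparison)
    show "\<forall>\<^sub>F i in sequentially. norm (X i z - F z) \<le> C * nrm ip (X i - F)"
      using C[of z "X _ - F"] X F z \<open>r > 0\<close> by simp
    show "(\<lambda>i. C * nrm ip (X i - F)) \<longlonglongrightarrow> 0"
      using tendsto_mult_left[OF lim, of C] by simp
  qed
  then show ?thesis
    by (simp add: LIM_zero_iff)
qed

lemma f_mem [simp]: "f i \<in> R"
  using generating by (simp add: generating_set_def)

lemma mult_mem [simp]: "\<phi> \<in> A_alg \<Omega> \<Longrightarrow> F \<in> R \<Longrightarrow> mult \<phi> F \<in> R"
  using quasi_free by (simp add: quasi_free_def)

text \<open>Elements of \<open>A_tens \<Omega>\<close> approximate \<open>F\<close> in norm, and the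
  locally uniform bound on evaluations turns this into locally uniform convergence of
  values.\<close>

lemma line_holomorphic_component:
  assumes F: "F \<in> R"
  shows "line_holomorphic \<Omega> (\<lambda>z. F z $ i)"
proof -
  have "F \<in> hclosure R ip (A_tens \<Omega>)"
    using quasi_free F by (simp add: quasi_free_def)
  then have "\<exists>G\<in>A_tens \<Omega>. nrm ip (F - G) < 1 / real (Suc k)" for k
    unfolding hclosure_def by simp
  then obtain X where X: "\<And>k. X k \<in> A_tens \<Omega>" and close: "\<And>k. nrm ip (F - X k) < 1 / real (Suc k)"
    by metis
  have XR: "X k \<in> R" for k
    using X quasi_free unfolding quasi_free_def by blast
  show ?thesis
  proof (rule line_holomorphic_uniform_limit[OF open_domain, where f = "\<lambda>k z. X k z $ i"])
    show "line_holomorphic \<Omega> (\<lambda>z. X k z $ i)" for k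
      using X[of k] A_alg_line_holomorphic[OF open_domain] by (simp add: A_tens_def)
    fix z assume "z \<in> \<Omega>"
    then obtain r C where r: "r > 0"
      and C: "\<And>w F. w \<in> \<Omega> \<inter> ball z r \<Longrightarrow> F \<in> R \<Longrightarrow> norm (F w) \<le> C * nrm ip F"
      using eval_bound by metis
    have "uniform_limit (\<Omega> \<inter> ball z r) (\<lambda>k z. X k z $ i) (\<lambda>z. F z $ i) sequentially"
      unfolding uniform_limit_iff
    proof (intro allI impI)
      fix e :: real assume "e > 0"
      have "(\<lambda>k. \<bar>C\<bar> * (1 / real (Suc k))) \<longlonglongrightarrow> \<bar>C\<bar> * 0"
        by (intro tendsto_mult tendsto_const LIMSEQ_Suc[OF lim_1_over_n])
      then have "\<forall>\<^sub>F k in sequentially. \<bar>C\<bar> * (1 / real (Suc k)) < e"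
        using \<open>e > 0\<close> order_tendstoD(2) by fastforce
      then show "\<forall>\<^sub>F k in sequentially. \<forall>w\<in>\<Omega> \<inter> ball z r. dist (X k w $ i) (F w $ i) < e"
      proof eventually_elim
        case (elim k)
        show ?case
        proof
          fix w assume w: "w \<in> \<Omega> \<inter> ball z r"
          have "dist (X k w $ i) (F w $ i) \<le> norm (F w - X k w)"
            using Finite_Cartesian_Product.norm_nth_le[of "F w - X k w" i] by (simp add: dist_norm norm_minus_commute)
          also have "\<dots> \<le> C * nrm ip (F - X k)"
            using C[OF w, of "F - X k"] F XR[of k] by simp
          also have "\<dots> \<le> \<bar>C\<bar> * (1 / real (Suc k))"
            using close[of k] F XR[of k] by (intro mult_mono) auto
          also have "\<dots> < e"
            by (rule elim)
          finally show "dist (X k w $ i) (F w $ i) < e" .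
        qed
      qed
    qed
    then show "\<exists>r>0. uniform_limit (\<Omega> \<inter> ball z r) (\<lambda>k z. X k z $ i) (\<lambda>z. F z $ i) sequentially"
      using r by blast
  qed
qed

text \<open>Over a point z, the vector cmat z *v F z consists of the coordinates of F z in the basis
  f i z of the fibre.  The functions u j w represent the j-th coordinate at w, so that L is the
  reproducing kernel written in the frame f.\<close>

definition gmat :: "complex^'n \<Rightarrow> complex^'m^'m" where
  "gmat z = (\<chi> i j. f j z $ i)"

definition cmat :: "complex^'n \<Rightarrow> complex^'m^'m" where
  "cmat z = matrix_inv (gmat z)"

lemma gmat_mult: "gmat z *v c = (\<Sum>i\<in>UNIV. c $ i *s f i z)"
  by (simp add: gmat_def matrix_vector_mult_def vec_eq_iff mult.commute)

lemma gmat_axis: "gmat z *v axis i 1 = f i z"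
  by (simp add: gmat_def matrix_vector_mult_axis vec_eq_iff)

section \<open>The submodule R_z and the fibre at z\<close>

lemma R_sub_vanishes:
  assumes z: "z \<in> \<Omega>" and h: "h \<in> R_sub \<Omega> R ip z"
  shows "h \<in> R" "h z = 0"
proof -
  define M where "M = {mult \<phi> h | \<phi> h. \<phi> \<in> A_alg \<Omega> \<and> \<phi> z = 0 \<and> h \<in> R}"
  show hR: "h \<in> R"
    using h by (simp add: R_sub_def hclosure_def)
  obtain r C where r: "r > 0"
    and C: "\<And>w F. w \<in> \<Omega> \<inter> ball z r \<Longrightarrow> F \<in> R \<Longrightarrow> norm (F w) \<le> C * nrm ip F"
    using eval_bound[OF z] by metis
  have "norm (h z) \<le> \<bar>C\<bar> * e" if "e > 0" for e
  proof -
    obtain g where g: "g \<in> fspan M" and close: "nrm ip (h - g) < e"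
      using h \<open>e > 0\<close> unfolding R_sub_def hclosure_def M_def by blast
    obtain K :: nat and c G where G: "\<And>k. k < K \<Longrightarrow> G k \<in> M" and g_eq: "g = (\<lambda>w. \<Sum>k<K. c k *s G k w)"
      using fspanE[OF g] by blast
    have "G k \<in> R \<and> G k z = 0" if "k < K" for k
      using G[OF that] by (auto simp: M_def) (simp add: mult_def)
    then have "g \<in> R" "g z = 0"
      unfolding g_eq by (auto intro!: lincomb_mem)
    then have "norm (h z) \<le> C * nrm ip (h - g)"
      using C[of z "h - g"] z r hR by simp
    also have "\<dots> \<le> \<bar>C\<bar> * e"
      using close hR \<open>g \<in> R\<close> by (intro mult_mono) auto
    finally show ?thesis .
  qed
  \<comment> \<open>Rescaling absorbs the constant; the added 1 avoids division by 0.\<close>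
  from this[of "e / (\<bar>C\<bar> + 1)" for e]
  have "norm (h z) \<le> \<bar>C\<bar> * (e / (\<bar>C\<bar> + 1))" if "e > 0" for e
    using that by (simp add: add_nonneg_pos)
  moreover have "\<bar>C\<bar> * (e / (\<bar>C\<bar> + 1)) \<le> e" if "e > 0" for e
    using that by (simp add: field_simps)
  ultimately have "norm (h z) \<le> e" if "e > 0" for e
    using that order_trans by blast
  then show "h z = 0"
    by (metis field_le_epsilon add_0 norm_le_zero_iff)
qed

lemma constant_mem:
  "(\<lambda>z. if z \<in> \<Omega> then v else 0) \<in> R"
proof -
  have "(\<lambda>z. (if z \<in> \<Omega> then v else 0) $ i) \<in> A_alg \<Omega>" for i
    unfolding A_alg_def mem_Collect_eq
  proof (intro allI impI)
    fix e :: real assume "e > 0"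
    moreover have "holo_on UNIV (\<lambda>z :: complex^'n. v $ i)"
      unfolding holo_on_def by (intro ballI exI[of _ "\<lambda>_. 0"]) auto
    ultimately show "\<exists>U g. open U \<and> closure \<Omega> \<subseteq> U \<and> holo_on U g \<and>
        (\<forall>z\<in>\<Omega>. cmod ((if z \<in> \<Omega> then v else 0) $ i - g z) < e)"
      by (intro exI[of _ UNIV] exI[of _ "\<lambda>z. v $ i"]) auto
  qed
  then have "(\<lambda>z. if z \<in> \<Omega> then v else 0) \<in> A_tens \<Omega>"
    by (simp add: A_tens_def)
  then show ?thesis
    using quasi_free unfolding quasi_free_def by blast
qed

lemma quotient_spanned:
  assumes "z \<in> \<Omega>" "h \<in> R"
  obtains c :: "'m \<Rightarrow> complex" where "h - (\<lambda>w. \<Sum>i\<in>UNIV. c i *s f i w) \<in> R_sub \<Omega> R ip z"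
  using generating assms unfolding generating_set_def by blast

text \<open>The constant function with value \<open>v\<close> is, modulo R_z, a combination of the
  \<open>f i\<close>. Evaluation at \<open>z\<close> annihilates R_z, so the m columns of
  \<open>gmat z\<close> span the m-dimensional fibre.\<close>

lemma det_gmat_nonzero:
  assumes z: "z \<in> \<Omega>"
  shows "det (gmat z) \<noteq> 0"
proof -
  have "\<exists>c. gmat z *v c = v" for v
  proof -
    obtain c where "(\<lambda>z. if z \<in> \<Omega> then v else 0) - (\<lambda>w. \<Sum>i\<in>UNIV. c i *s f i w) \<in> R_sub \<Omega> R ip z"
      using quotient_spanned[OF z constant_mem] by blast
    from R_sub_vanishes(2)[OF z this] have "v = gmat z *v (\<chi> i. c i)"
      using z by (simp add: gmat_mult)
    then show ?thesis by metis
  qed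
  then have "surj ((*v) (gmat z))"
    by (metis surjI)
  then show ?thesis
    by (metis matrix_right_invertible_surjective invertible_right_inverse invertible_det_nz)
qed

lemma
  assumes z: "z \<in> \<Omega>"
  shows gmat_cmat: "gmat z *v (cmat z *v v) = v" and cmat_gmat: "cmat z *v (gmat z *v v) = v"
  using matrix_inv_right[of "gmat z"] matrix_inv_left[of "gmat z"] det_gmat_nonzero[OF z]
  by (simp_all add: cmat_def matrix_vector_mul_assoc)

text \<open>For the inclusion that is not mere continuity of evaluation: modulo R_z, a function
  vanishing at \<open>z\<close> is a combination of the \<open>f i\<close>, and evaluation forces
  its coefficients into the kernel of the invertible matrix \<open>gmat z\<close>.\<close>

lemma R_sub_eq:
  assumes z: "z \<in> \<Omega>"
  shows "R_sub \<Omega> R ip z = {h \<in> R. h z = 0}"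
proof (intro equalityI subsetI)
  fix h assume h: "h \<in> {h \<in> R. h z = 0}"
  then obtain c where c: "h - (\<lambda>w. \<Sum>i\<in>UNIV. c i *s f i w) \<in> R_sub \<Omega> R ip z"
    using quotient_spanned[OF z] by blast
  from R_sub_vanishes(2)[OF z c] have "gmat z *v (\<chi> i. c i) = 0"
    using h by (simp add: gmat_mult)
  then have "(\<chi> i. c i) = 0"
    using cmat_gmat[OF z, of "\<chi> i. c i"] by simp
  then have "c i = 0" for i
    by (simp add: vec_eq_iff)
  then show "h \<in> R_sub \<Omega> R ip z"
    using c by (simp add: fun_diff_def)
qed (use R_sub_vanishes[OF z] in auto)

lemma closed_subspace_vanishing:
  assumes z: "z \<in> \<Omega>"
  shows "closed_subspace {h \<in> R. h z = 0}"
  unfolding closed_subspace_def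
proof (intro conjI allI impI)
  fix X F assume X: "\<forall>i::nat. X i \<in> {h \<in> R. h z = 0}" and F: "F \<in> R"
    and lim: "(\<lambda>i. nrm ip (X i - F)) \<longlonglongrightarrow> 0"
  have "(\<lambda>i. X i z) \<longlonglongrightarrow> F z"
    using X F lim by (intro eval_tendsto z) auto
  then show "F \<in> {h \<in> R. h z = 0}"
    using X F by (simp add: LIMSEQ_const_iff)
qed (auto, simp add: smult_f_def)

lemma line_holomorphic_cmat: "line_holomorphic \<Omega> (\<lambda>z. cmat z $ k $ l)"
proof -
  have hol: "line_holomorphic \<Omega> (\<lambda>z. gmat z $ i $ j)" for i j
    by (simp add: gmat_def line_holomorphic_component)
  have "line_holomorphic \<Omega>
      (\<lambda>z. det (\<chi> i j. if j = k then axis l 1 $ i else gmat z $ i $ j) / det (gmat z))"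
  proof (intro line_holomorphic_divide line_holomorphic_det hol det_gmat_nonzero)
    show "line_holomorphic \<Omega> (\<lambda>z. (\<chi> i j. if j = k then axis l 1 $ i else gmat z $ i $ j) $ i $ j)" for i j
      by (cases "j = k") (simp_all add: hol line_holomorphic_const)
  qed
  then show ?thesis
    using line_holomorphic_cong[of \<Omega> "\<lambda>z. cmat z $ k $ l"]
    by (simp add: cmat_def matrix_inv_entry det_gmat_nonzero)
qed

lemma line_holomorphic_coeff:
  assumes "F \<in> R" shows "line_holomorphic \<Omega> (\<lambda>z. (cmat z *v F z) $ k)"
  unfolding matrix_vector_mult_def
  by (simp, intro line_holomorphic_sum line_holomorphic_mult line_holomorphic_cmat
      line_holomorphic_component assms)

lemma coeff_bound:
  "cmod ((cmat z *v v) $ k) \<le> (\<Sum>l\<in>UNIV. cmod (cmat z $ k $ l)) * norm v"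
proof -
  have "cmod ((cmat z *v v) $ k) \<le> (\<Sum>l\<in>UNIV. cmod (cmat z $ k $ l * v $ l))"
    by (simp add: matrix_vector_mult_def norm_sum)
  also have "\<dots> \<le> (\<Sum>l\<in>UNIV. cmod (cmat z $ k $ l) * norm v)"
    by (intro sum_mono) (simp add: norm_mult mult_left_mono Finite_Cartesian_Product.norm_nth_le)
  finally show ?thesis
    by (simp add: sum_distrib_right)
qed

section \<open>Kernel functions and the kernel matrix\<close>

definition u :: "'m \<Rightarrow> complex^'n \<Rightarrow> ('n, 'm) vfun" where
  "u j w = (SOME u. u \<in> R \<and> (\<forall>F\<in>R. ip F u = (cmat w *v F w) $ j))"

text \<open>The coordinate functional at \<open>w\<close> is a fixed linear form composed with the
  bounded evaluation at \<open>w\<close>, so the Riesz representation provides a witness for the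
  choice in \<open>u\<close>.\<close>

lemma
  assumes w: "w \<in> \<Omega>"
  shows u_mem [simp]: "u j w \<in> R"
    and ip_u: "F \<in> R \<Longrightarrow> ip F (u j w) = (cmat w *v F w) $ j"
proof -
  obtain r C where r: "r > 0"
    and C: "\<And>v F. v \<in> \<Omega> \<inter> ball w r \<Longrightarrow> F \<in> R \<Longrightarrow> norm (F v) \<le> C * nrm ip F"
    using eval_bound[OF w] by metis
  have "cmod ((cmat w *v F w) $ j) \<le> (\<Sum>l\<in>UNIV. cmod (cmat w $ j $ l)) * C * nrm ip F" if "F \<in> R" for F
  proof -
    have "cmod ((cmat w *v F w) $ j) \<le> (\<Sum>l\<in>UNIV. cmod (cmat w $ j $ l)) * norm (F w)"
      by (rule coeff_bound)
    also have "\<dots> \<le> (\<Sum>l\<in>UNIV. cmod (cmat w $ j $ l)) * (C * nrm ip F)"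
      using C[of w F] w r that by (intro mult_left_mono) (auto intro: sum_nonneg)
    finally show ?thesis by (simp add: mult.assoc)
  qed
  then obtain v where "v \<in> R" "\<And>F. F \<in> R \<Longrightarrow> ip F v = (cmat w *v F w) $ j"
    by (rule riesz_representation[where l = "\<lambda>F. (cmat w *v F w) $ j", rotated 2])
      (auto simp: matrix_vector_right_distrib smult_f_def vector_scalar_commute)
  then have "\<exists>v. v \<in> R \<and> (\<forall>F\<in>R. ip F v = (cmat w *v F w) $ j)"
    by blast
  from someI_ex[OF this] show "u j w \<in> R" "F \<in> R \<Longrightarrow> ip F (u j w) = (cmat w *v F w) $ j"
    unfolding u_def by blast+
qed

definition L :: "complex^'n \<Rightarrow> complex^'n \<Rightarrow> 'm \<Rightarrow> 'm \<Rightarrow> complex" where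
  "L z w i j = (cmat z *v u j w z) $ i"

lemma L_eq_ip: "z \<in> \<Omega> \<Longrightarrow> w \<in> \<Omega> \<Longrightarrow> L z w i j = ip (u j w) (u i z)"
  by (simp add: L_def ip_u)

lemma L_cnj: "z \<in> \<Omega> \<Longrightarrow> w \<in> \<Omega> \<Longrightarrow> cnj (L z w i j) = L w z j i"
  by (simp add: L_eq_ip ip_cnj[of "u j w" "u i z"])

lemma line_holomorphic_L: "w \<in> \<Omega> \<Longrightarrow> line_holomorphic \<Omega> (\<lambda>z. L z w i j)"
  unfolding L_def by (intro line_holomorphic_coeff u_mem)

text \<open>Hermitian symmetry makes this the holomorphy in the first variable with the indices
  exchanged.\<close>

lemma line_holomorphic_cnj_L: "z \<in> \<Omega> \<Longrightarrow> line_holomorphic \<Omega> (\<lambda>w. cnj (L z w i j))"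
  using line_holomorphic_cong[of \<Omega> "\<lambda>w. cnj (L z w i j)" "\<lambda>w. L w z j i"]
  by (simp add: L_cnj line_holomorphic_L)

text \<open>The reproducing property writes the squared norm of \<open>u i z\<close> as a coordinate
  of its own value at \<open>z\<close>. This is at most a bound for \<open>cmat z\<close> times the
  evaluation bound times the norm itself, so one factor of the norm cancels. The bound on
  \<open>cmat\<close> is the one known only along lines.\<close>

lemma line_bounded_nrm_u: "line_bounded \<Omega> (\<lambda>z. nrm ip (u i z))"
  unfolding line_bounded_def
proof (intro allI ballI)
  fix a b t assume t: "t \<in> line_preimage \<Omega> a b"
  define N where "N = (\<lambda>z. \<Sum>l\<in>UNIV. cmod (cmat z $ i $ l))"
  have N0: "0 \<le> N z" for z by (simp add: N_def sum_nonneg)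
  have "line_bounded \<Omega> N"
    unfolding N_def
    by (intro line_bounded_sum line_holomorphic_imp_line_bounded open_domain line_holomorphic_cmat) auto
  then obtain r1 M where r1: "r1 > 0"
    and M: "\<And>s. s \<in> ball t r1 \<inter> line_preimage \<Omega> a b \<Longrightarrow> N (a + s *s b) \<le> M"
    using t unfolding line_bounded_def by blast
  obtain r C where r: "r > 0"
    and C: "\<And>w F. w \<in> \<Omega> \<inter> ball (a + t *s b) r \<Longrightarrow> F \<in> R \<Longrightarrow> norm (F w) \<le> C * nrm ip F"
    using eval_bound t by (metis in_line_preimage)
  have "open (line_preimage (ball (a + t *s b) r) a b)" "t \<in> line_preimage (ball (a + t *s b) r) a b"
    using r by (auto intro: open_line_preimage)
  then obtain r2 where r2: "r2 > 0" "ball t r2 \<subseteq> line_preimage (ball (a + t *s b) r) a b"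
    using openE by blast
  have "nrm ip (u i (a + s *s b)) \<le> M * \<bar>C\<bar>" if s: "s \<in> ball t (min r1 r2) \<inter> line_preimage \<Omega> a b" for s
  proof -
    define z where "z = a + s *s b"
    have z: "z \<in> \<Omega> \<inter> ball (a + t *s b) r" "N z \<le> M"
      using s r2 M[of s] by (auto simp: z_def subset_iff)
    have u: "u i z \<in> R" using z by simp
    have "(nrm ip (u i z))\<^sup>2 = cmod (ip (u i z) (u i z))"
      using u by (simp add: ip_self del: of_real_power)
    also have "\<dots> \<le> N z * norm (u i z z)"
      using ip_u[of z "u i z" i] z u coeff_bound[of z "u i z z" i] by (simp add: N_def)
    also have "\<dots> \<le> M * (C * nrm ip (u i z))"
      using z C[OF z(1) u] N0[of z] by (intro mult_mono) auto
    also have "\<dots> \<le> M * \<bar>C\<bar> * nrm ip (u i z)"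
      using z u N0[of z] by (simp add: mult_left_mono mult_right_mono mult.assoc)
    finally have "nrm ip (u i z) * nrm ip (u i z) \<le> M * \<bar>C\<bar> * nrm ip (u i z)"
      by (simp add: power2_eq_square)
    moreover have "0 \<le> M * \<bar>C\<bar>"
      using z N0[of z] by simp
    ultimately show ?thesis
      using u nrm_nonneg[OF u] unfolding z_def[symmetric]
      by (cases "nrm ip (u i z) = 0") auto
  qed
  then show "\<exists>r>0. \<exists>M. \<forall>s\<in>ball t r \<inter> line_preimage \<Omega> a b. nrm ip (u i (a + s *s b)) \<le> M"
    using r1 r2(1) by (intro exI[of _ "min r1 r2"] conjI exI[of _ "M * \<bar>C\<bar>"] ballI) auto
qed

lemma L_bound: "z \<in> \<Omega> \<Longrightarrow> w \<in> \<Omega> \<Longrightarrow> cmod (L z w i j) \<le> nrm ip (u i z) * nrm ip (u j w)"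
  by (simp add: L_eq_ip cauchy_schwarz mult.commute[of "nrm ip (u i z)"])

text \<open>These facts rest on the description in \<open>loc_rep\<close> having exactly one
  solution: \<open>h\<close> minus its projection onto R_z is one, and two solutions differ by an
  element of R_z that is orthogonal to itself.\<close>

lemma
  assumes z: "z \<in> \<Omega>" and h: "h \<in> R"
  shows loc_rep_mem: "loc_rep \<Omega> R ip z h \<in> R"
    and loc_rep_eval: "loc_rep \<Omega> R ip z h z = h z"
    and loc_rep_orthogonal: "g \<in> R \<Longrightarrow> g z = 0 \<Longrightarrow> ip (loc_rep \<Omega> R ip z h) g = 0"
proof -
  let ?P = "\<lambda>u. u \<in> R \<and> h - u \<in> R_sub \<Omega> R ip z \<and> (\<forall>g\<in>R_sub \<Omega> R ip z. ip u g = 0)"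
  obtain v where v: "v \<in> {h \<in> R. h z = 0}" and orth: "\<And>s. s \<in> {h \<in> R. h z = 0} \<Longrightarrow> ip (h - v) s = 0"
    using projection_exists[OF closed_subspace_vanishing[OF z] h] by blast
  have "?P (h - v)"
    using v orth h by (auto simp: R_sub_eq[OF z])
  moreover have "u = u'" if "?P u" "?P u'" for u u'
  proof -
    have "u - u' \<in> R" "(u - u') z = 0"
      using that by (auto simp: R_sub_eq[OF z])
    then have "ip (u - u') (u - u') = 0"
      using that ip_diff[of u u' "u - u'"] by (auto simp: R_sub_eq[OF z])
    then show ?thesis
      using ip_self_eq_0[of "u - u'"] \<open>u - u' \<in> R\<close> by simp
  qed
  ultimately have "\<exists>!u. ?P u"
    by blast
  from theI'[OF this] have "?P (loc_rep \<Omega> R ip z h)"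
    unfolding loc_rep_def .
  then show "loc_rep \<Omega> R ip z h \<in> R" "loc_rep \<Omega> R ip z h z = h z"
    "g \<in> R \<Longrightarrow> g z = 0 \<Longrightarrow> ip (loc_rep \<Omega> R ip z h) g = 0"
    by (auto simp: R_sub_eq[OF z])
qed

text \<open>The representatives of the f i form a basis of the orthogonal complement of the functions
  vanishing at z, and the u j z are its dual basis.\<close>

lemma gram_inverse:
  assumes z: "z \<in> \<Omega>"
  shows "(\<chi> i k. loc_ip \<Omega> R ip z (f i) (f k)) ** (\<chi> k j. cnj (L z z k j)) = mat 1"
proof -
  define p where "p = (\<lambda>i. loc_rep \<Omega> R ip z (f i))"
  have p: "p i \<in> R" "p i z = f i z" "g \<in> R \<Longrightarrow> g z = 0 \<Longrightarrow> ip (p i) g = 0" for i g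
    unfolding p_def by (rule loc_rep_mem loc_rep_eval loc_rep_orthogonal z f_mem | assumption)+
  \<comment> \<open>The coefficients are the coordinates of \<open>u j z z\<close>, so the
    difference of the two sides vanishes at \<open>z\<close>. It is therefore orthogonal to
    \<open>u j z\<close>, which tests only the value at \<open>z\<close>, and to every
    \<open>p k\<close>; hence to itself.\<close>
  have u_eq: "u j z = (\<lambda>w. \<Sum>k\<in>UNIV. L z z k j *s p k w)" for j
  proof -
    define s where "s = (\<lambda>w. \<Sum>k\<in>UNIV. L z z k j *s p k w)"
    have sR: "s \<in> R"
      unfolding s_def using p by (intro lincomb_mem) auto
    have uR: "u j z \<in> R" using z by simp
    have "s z = gmat z *v (cmat z *v u j z z)"
      by (simp add: s_def p L_def gmat_mult)
    then have 0: "(u j z - s) z = 0"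
      by (simp add: gmat_cmat[OF z])
    have "ip (u j z - s) (u j z) = 0"
      using ip_u[OF z, of "u j z - s"] uR sR 0 by simp
    moreover have "ip (u j z - s) s = (\<Sum>k\<in>UNIV. cnj (L z z k j) * ip (u j z - s) (p k))"
      unfolding s_def using p uR sR by (intro ip_lincomb_right) (auto simp flip: s_def)
    moreover have "ip (u j z - s) (p k) = 0" for k
      using p(3)[of "u j z - s" k] 0 p(1) uR sR ip_cnj[of "p k" "u j z - s"] by simp
    ultimately have "ip (u j z - s) (u j z - s) = 0"
      using uR sR by (simp add: ip_diff_right del: minus_apply)
    then show ?thesis
      using ip_self_eq_0[of "u j z - s"] uR sR unfolding s_def by simp
  qed
  have "(\<Sum>k\<in>UNIV. loc_ip \<Omega> R ip z (f i) (f k) * cnj (L z z k j)) = mat 1 $ i $ j" for i j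
  proof -
    have "(\<Sum>k\<in>UNIV. loc_ip \<Omega> R ip z (f i) (f k) * cnj (L z z k j)) = ip (p i) (u j z)"
      unfolding u_eq using p(1)
      by (subst ip_lincomb_right) (auto simp: loc_ip_def p_def mult.commute)
    also have "\<dots> = (cmat z *v (gmat z *v axis i 1)) $ j"
      using ip_u[OF z p(1)] by (simp add: p gmat_axis)
    also have "\<dots> = mat 1 $ i $ j"
      by (simp add: cmat_gmat[OF z] axis_def mat_def)
    finally show ?thesis .
  qed
  then show ?thesis
    by (simp add: matrix_matrix_mult_def vec_eq_iff)
qed

text \<open>A function all of whose frame coordinates vanish is zero. This is the density of the
  span of the kernel functions, in the form used with orthogonal projections.\<close>

lemma u_total:
  assumes h: "h \<in> R" and orth: "\<And>j w. w \<in> \<Omega> \<Longrightarrow> ip h (u j w) = 0"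
  shows "h = 0"
proof
  fix w
  show "h w = 0 w"
  proof (cases "w \<in> \<Omega>")
    case True
    then have "cmat w *v h w = 0"
      using orth h by (simp add: ip_u vec_eq_iff)
    then show ?thesis
      using gmat_cmat[OF True, of "h w"] by simp
  qed (use h in simp)
qed

end

section \<open>Modules with equal localized Gram matrices\<close>

text \<open>The assumptions are symmetric in the two modules, so a second interpretation with the
  roles exchanged will supply the inverse map.\<close>

locale matched_modules =
  M: generated_module \<Omega> R ip f + M': generated_module \<Omega> R' ip' f'
  for \<Omega> :: "(complex^'n::finite) set" and R R' :: "('n, 'm::finite) vfun set" and ip ip' f f' +
  assumes connected_domain: "connected \<Omega>"
    and loc_ip_eq: "z \<in> \<Omega> \<Longrightarrow> loc_ip \<Omega> R ip z (f i) (f j) = loc_ip \<Omega> R' ip' z (f' i) (f' j)"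
begin

section \<open>Equality of the two kernels\<close>

lemma L_eq_diagonal:
  assumes z: "z \<in> \<Omega>"
  shows "M.L z z i j = M'.L z z i j"
proof -
  let ?A = "\<chi> i k. loc_ip \<Omega> R ip z (f i) (f k)"
  let ?B = "\<chi> k j. cnj (M.L z z k j)" and ?B' = "\<chi> k j. cnj (M'.L z z k j)"
  have AB: "?A ** ?B = mat 1" and AB': "?A ** ?B' = mat 1"
    using M.gram_inverse[OF z] M'.gram_inverse[OF z] by (simp_all add: loc_ip_eq[OF z])
  \<comment> \<open>Both kernel matrices are right inverses of the same square Gram matrix, and such
    an inverse is unique.\<close>
  have "?B' = (?B ** ?A) ** ?B'"
    using AB by (simp add: matrix_left_right_inverse)
  also have "\<dots> = ?B"
    using AB' by (simp flip: matrix_mul_assoc)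
  finally have "?B' $ i $ j = ?B $ i $ j"
    by (rule arg_cong)
  then show ?thesis
    by simp
qed

text \<open>Polarization works in a convex set, which \<open>\<Omega>\<close> need not be; the
  passage to all of \<open>\<Omega>\<close> is left to the identity theorem.\<close>

lemma L_eq_ball:
  assumes ball: "ball c r \<subseteq> \<Omega>" and z: "z \<in> ball c r" and w: "w \<in> ball c r"
  shows "M.L z w i j = M'.L z w i j"
proof -
  \<comment> \<open>Summing over all indices and both modules gives a single function that dominates
    the factor at \<open>z\<close>, with index \<open>i\<close>, as well as the factor at
    \<open>w\<close>, with index \<open>j\<close>.\<close>
  define N where "N = (\<lambda>z. \<Sum>i\<in>UNIV. nrm ip (M.u i z) + nrm ip' (M'.u i z))"
  have u0: "0 \<le> nrm ip (M.u i z)" "0 \<le> nrm ip' (M'.u i z)" if "z \<in> \<Omega>" for i z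
    using that by simp_all
  have uN: "nrm ip (M.u i z) + nrm ip' (M'.u i z) \<le> N z" if "z \<in> \<Omega>" for i z
    unfolding N_def using that u0 by (intro member_le_sum) (auto intro: add_nonneg_nonneg)
  have "M.L z w i j - M'.L z w i j = 0"
  proof (rule sesquiholomorphic_polarization[where B = "ball c r" and N = N
        and G = "\<lambda>z w. M.L z w i j - M'.L z w i j"])
    show "line_holomorphic (ball c r) (\<lambda>z. M.L z w i j - M'.L z w i j)" if "w \<in> ball c r" for w
      using that ball
      by (intro line_holomorphic_subset[OF _ ball] line_holomorphic_diff M.line_holomorphic_L M'.line_holomorphic_L) auto
    show "line_holomorphic (ball c r) (\<lambda>w. cnj (M.L z w i j - M'.L z w i j))" if "z \<in> ball c r" for z
      using that ball unfolding complex_cnj_diff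
      by (intro line_holomorphic_subset[OF _ ball] line_holomorphic_diff
          M.line_holomorphic_cnj_L M'.line_holomorphic_cnj_L) auto
    show "line_bounded (ball c r) N"
      unfolding N_def
      by (intro line_bounded_subset[OF _ ball] line_bounded_sum line_bounded_add
          M.line_bounded_nrm_u M'.line_bounded_nrm_u finite)
    show "cmod (M.L z w i j - M'.L z w i j) \<le> N z * N w" if "z \<in> ball c r" "w \<in> ball c r" for z w
    proof -
      have zw: "z \<in> \<Omega>" "w \<in> \<Omega>"
        using that ball by auto
      have "cmod (M.L z w i j - M'.L z w i j) \<le>
          nrm ip (M.u i z) * nrm ip (M.u j w) + nrm ip' (M'.u i z) * nrm ip' (M'.u j w)"
        using M.L_bound[OF zw] M'.L_bound[OF zw] by (intro order_trans[OF norm_triangle_ineq4] add_mono)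
      also have "\<dots> \<le> (nrm ip (M.u i z) + nrm ip' (M'.u i z)) * (nrm ip (M.u j w) + nrm ip' (M'.u j w))"
        using u0 zw by (simp add: algebra_simps)
      also have "\<dots> \<le> N z * N w"
        using u0 uN zw by (intro mult_mono order_trans[OF _ uN[of z i]]) auto
      finally show ?thesis .
    qed
    show "0 \<le> N z" if "z \<in> ball c r" for z
      unfolding N_def using that ball u0 by (intro sum_nonneg add_nonneg_nonneg) auto
    show "M.L z z i j - M'.L z z i j = 0" if "z \<in> ball c r" for z
      using that ball L_eq_diagonal by auto
  qed (use z w in auto)
  then show ?thesis by simp
qed

text \<open>With the second point kept in a small ball around \<open>z\<close>, the identity theorem
  frees the first one; Hermitian symmetry then puts the two points in the required order.\<close>

lemma L_eq:
  assumes z: "z \<in> \<Omega>" and w: "w \<in> \<Omega>"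
  shows "M.L z w i j = M'.L z w i j"
proof -
  obtain r where r: "r > 0" "ball z r \<subseteq> \<Omega>"
    using M.open_domain z openE by blast
  have near: "M.L v y i j = M'.L v y i j" if v: "v \<in> \<Omega>" and y: "y \<in> ball z r" for v y i j
  proof -
    have "M.L v y i j - M'.L v y i j = 0"
      using r y
      by (intro line_identity_theorem[where g = "\<lambda>v. M.L v y i j - M'.L v y i j",
            OF M.open_domain connected_domain _ r _ v])
        (auto intro!: line_holomorphic_diff M.line_holomorphic_L M'.line_holomorphic_L L_eq_ball)
    then show ?thesis by simp
  qed
  have "M.L w z j i = M'.L w z j i"
    using near w r by simp
  then have "cnj (M.L w z j i) = cnj (M'.L w z j i)"
    by simp
  then show ?thesis
    by (simp add: M.L_cnj M'.L_cnj z w)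
qed

text \<open>The bundle map carrying the basis \<open>f i z\<close> of each fibre to
  \<open>f' i z\<close>. Being defined pointwise on arbitrary functions, it is linear and commutes
  with multiplication before anything is known about norms or membership in
  \<open>R'\<close>.\<close>

definition T :: "('n, 'm) vfun \<Rightarrow> ('n, 'm) vfun" where
  "T h = (\<lambda>z. if z \<in> \<Omega> then M'.gmat z *v (M.cmat z *v h z) else 0)"

lemma T_add: "T (h + k) = T h + T k"
  by (simp add: T_def fun_eq_iff matrix_vector_right_distrib)

lemma T_smult: "T (smult_f c h) = smult_f c (T h)"
  by (simp add: T_def fun_eq_iff smult_f_def vector_scalar_commute)

lemma T_mult: "T (mult \<phi> h) = mult \<phi> (T h)"
  by (simp add: T_def fun_eq_iff mult_def vector_scalar_commute)

lemma T_diff: "T (h - k) = T h - T k"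
  by (simp add: T_def fun_eq_iff matrix_vector_mult_diff_distrib)

lemma T_zero: "T 0 = 0"
  by (simp add: T_def fun_eq_iff)

lemma T_lincomb:
  "finite K \<Longrightarrow> T (\<lambda>w. \<Sum>k\<in>K. c k *s g k w) = (\<lambda>w. \<Sum>k\<in>K. c k *s T (g k) w)"
proof (induction K rule: finite_induct)
  case (insert a K)
  have "(\<lambda>w. \<Sum>k\<in>insert a K. c k *s g k w) = smult_f (c a) (g a) + (\<lambda>w. \<Sum>k\<in>K. c k *s g k w)"
    using insert by (simp add: fun_eq_iff smult_f_def)
  then have "T (\<lambda>w. \<Sum>k\<in>insert a K. c k *s g k w) = smult_f (c a) (T (g a)) + T (\<lambda>w. \<Sum>k\<in>K. c k *s g k w)"
    by (simp only: T_add T_smult)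
  then show ?case
    using insert by (simp add: fun_eq_iff smult_f_def)
qed (use T_zero in \<open>simp add: zero_fun_def\<close>)

lemma cmat_T: "z \<in> \<Omega> \<Longrightarrow> M'.cmat z *v T h z = M.cmat z *v h z"
  by (simp add: T_def M'.cmat_gmat)

text \<open>Here the equality of kernels is used: the entries of \<open>L\<close> are the frame
  coordinates of the kernel functions, and \<open>T\<close> preserves coordinates.\<close>

lemma T_u:
  assumes w: "w \<in> \<Omega>"
  shows "T (M.u j w) = M'.u j w"
proof
  fix z
  show "T (M.u j w) z = M'.u j w z"
  proof (cases "z \<in> \<Omega>")
    case True
    have "M.cmat z *v M.u j w z = M'.cmat z *v M'.u j w z"
      using L_eq[OF True w] by (simp add: M.L_def M'.L_def vec_eq_iff)
    then show ?thesis
      using True by (simp add: T_def M'.gmat_cmat)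
  qed (use w in \<open>simp add: T_def\<close>)
qed

lemma T_f: "T (f i) = f' i"
proof
  fix z
  show "T (f i) z = f' i z"
    using M.cmat_gmat[of z "axis i 1"]
    by (cases "z \<in> \<Omega>") (simp_all add: T_def M.gmat_axis M'.gmat_axis)
qed

lemma T_tendsto:
  assumes z: "z \<in> \<Omega>" and lim: "(\<lambda>i. X i z) \<longlonglongrightarrow> F z"
  shows "(\<lambda>i. T (X i) z) \<longlonglongrightarrow> T F z"
proof -
  have "continuous_on UNIV (\<lambda>v. M'.gmat z *v (M.cmat z *v v))"
    unfolding matrix_vector_mult_def by (intro continuous_intros continuous_on_vec_lambda)
  then show ?thesis
    using z continuous_on_tendsto_compose[OF _ lim, of UNIV "\<lambda>v. M'.gmat z *v (M.cmat z *v v)"]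
    by (simp add: T_def)
qed

text \<open>The part of \<open>R\<close> where \<open>T\<close> is known to behave well. Pairing
  with every admissible \<open>h\<close>, instead of demanding equal norms, makes the condition
  linear in \<open>k\<close>; the restriction \<open>T h \<in> R'\<close> keeps the pairing in
  \<open>R'\<close> meaningful while the range of \<open>T\<close> is still unknown.\<close>

definition E :: "('n, 'm) vfun set" where
  "E = {k \<in> R. T k \<in> R' \<and> (\<forall>h\<in>R. T h \<in> R' \<longrightarrow> ip' (T k) (T h) = ip k h)}"

lemma nrm_T_E: "k \<in> E \<Longrightarrow> nrm ip' (T k) = nrm ip k"
  by (simp add: E_def nrm_def)

lemma E_diff: "h \<in> E \<Longrightarrow> k \<in> E \<Longrightarrow> h - k \<in> E"
  by (auto simp: E_def T_diff M.ip_diff M'.ip_diff)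

text \<open>For limits: \<open>T\<close> is isometric on \<open>E\<close>, so images of a convergent
  sequence are Cauchy in \<open>R'\<close>. Their norm limit must be \<open>T F\<close>, because
  evaluations are continuous in both modules and \<open>T\<close> acts by a fixed matrix at each
  point.\<close>

lemma closed_subspace_E: "M.closed_subspace E"
  unfolding M.closed_subspace_def
proof (intro conjI allI impI ballI)
  show "E \<subseteq> R"
    by (auto simp: E_def)
  show "0 \<in> E"
    by (simp add: E_def T_zero M.ip_zero M'.ip_zero)
  show "F + G \<in> E" if "F \<in> E" "G \<in> E" for F G
    using that by (simp add: E_def T_add M.ip_add M'.ip_add)
  show "smult_f c F \<in> E" if "F \<in> E" for c F
    using that by (simp add: E_def T_smult M.ip_smult M'.ip_smult)
  fix X F assume "\<forall>i::nat. X i \<in> E" and F: "F \<in> R" and lim: "(\<lambda>i. nrm ip (X i - F)) \<longlonglongrightarrow> 0"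
  then have X: "X i \<in> E" "X i \<in> R" "T (X i) \<in> R'" for i
    by (auto simp: E_def)
  have "cauchy_in R ip X"
    using M.convergent_imp_cauchy X F lim by blast
  then have "cauchy_in R' ip' (\<lambda>i. T (X i))"
    using X nrm_T_E[OF E_diff[OF X(1) X(1)]] by (simp add: cauchy_in_def T_diff)
  then obtain G where G: "G \<in> R'" and limG: "(\<lambda>i. nrm ip' (T (X i) - G)) \<longlonglongrightarrow> 0"
    using M'.complete by blast
  have "T F z = G z" for z
  proof (cases "z \<in> \<Omega>")
    case True
    have "(\<lambda>i. T (X i) z) \<longlonglongrightarrow> T F z"
      using M.eval_tendsto[OF True X(2) F lim] by (rule T_tendsto[OF True])
    then show ?thesis
      using M'.eval_tendsto[OF True X(3) G limG] LIMSEQ_unique by blast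
  qed (use G in \<open>simp add: T_def\<close>)
  then have TF: "T F = G" by (rule ext)
  have "ip' (T F) (T h) = ip F h" if h: "h \<in> R" "T h \<in> R'" for h
  proof (rule LIMSEQ_unique)
    show "(\<lambda>i. ip (X i) h) \<longlonglongrightarrow> ip F h"
      using X F h lim by (intro M.tendsto_ip)
    have "(\<lambda>i. ip' (T (X i)) (T h)) \<longlonglongrightarrow> ip' G (T h)"
      using X G h limG by (intro M'.tendsto_ip)
    moreover have "ip' (T (X i)) (T h) = ip (X i) h" for i
      using X(1)[of i] h by (simp add: E_def)
    ultimately show "(\<lambda>i. ip (X i) h) \<longlonglongrightarrow> ip' (T F) (T h)"
      by (simp add: TF)
  qed
  then show "F \<in> E"
    using F G by (simp add: E_def TF)
qed

text \<open>By the reproducing property, both pairings are the conjugate of the same frame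
  coordinate at \<open>w\<close>.\<close>

lemma u_in_E:
  assumes w: "w \<in> \<Omega>"
  shows "M.u j w \<in> E"
proof -
  have "ip' (M'.u j w) (T h) = ip (M.u j w) h" if h: "h \<in> R" "T h \<in> R'" for h
    using w h M.ip_cnj[of h "M.u j w"] M'.ip_cnj[of "T h" "M'.u j w"]
    by (simp add: M.ip_u M'.ip_u cmat_T)
  then show ?thesis
    using w by (simp add: E_def T_u)
qed

text \<open>What the projection onto \<open>E\<close> leaves over is orthogonal to all kernel
  functions, hence zero.\<close>

lemma E_eq: "E = R"
proof (intro equalityI subsetI)
  fix h assume h: "h \<in> R"
  obtain v where v: "v \<in> E" and orth: "\<And>s. s \<in> E \<Longrightarrow> ip (h - v) s = 0"
    using M.projection_exists[OF closed_subspace_E h] by blast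
  have "h - v = 0"
    using h v u_in_E by (intro M.u_total orth) (auto simp: E_def)
  then show "h \<in> E"
    using v by simp
qed (simp add: E_def)

lemma T_mem: "h \<in> R \<Longrightarrow> T h \<in> R'"
  using E_eq by (auto simp: E_def)

lemma T_ip: "h \<in> R \<Longrightarrow> k \<in> R \<Longrightarrow> ip' (T h) (T k) = ip h k"
  using E_eq T_mem by (auto simp: E_def)

lemma T_nrm: "h \<in> R \<Longrightarrow> nrm ip' (T h) = nrm ip h"
  by (simp add: nrm_def T_ip)

text \<open>The set \<open>S\<close> is the graph of \<open>T\<close> over the span of the multiples
  of the \<open>f i\<close>. Passing to its closure adds nothing outside the graph of
  \<open>T\<close>, since \<open>T\<close> is isometric, and reaches all of that graph, since the
  span is dense.\<close>

lemma delta_graph_eq: "delta_graph \<Omega> R ip R' ip' f f' = {(h, T h) | h. h \<in> R}"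
proof -
  define S where "S = {(h, h'). \<exists>(N::nat) (c::nat \<Rightarrow> complex) \<phi> (i::nat \<Rightarrow> 'm). (\<forall>k<N. \<phi> k \<in> A_alg \<Omega>) \<and>
                  h = (\<lambda>w. \<Sum>k<N. c k *s mult (\<phi> k) (f (i k)) w) \<and>
                  h' = (\<lambda>w. \<Sum>k<N. c k *s mult (\<phi> k) (f' (i k)) w)}"
  have delta: "delta_graph \<Omega> R ip R' ip' f f' = {(h, h'). h \<in> R \<and> h' \<in> R' \<and>
      (\<forall>e>0. \<exists>(g, g')\<in>S. sqrt ((nrm ip (h - g))\<^sup>2 + (nrm ip' (h' - g'))\<^sup>2) < e)}"
    by (simp add: delta_graph_def S_def Let_def)
  have S_graph: "g \<in> R \<and> g' = T g" if "(g, g') \<in> S" for g g'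
    using that unfolding S_def by (auto simp: T_lincomb T_mult T_f intro!: M.lincomb_mem)
  have "h' = T h" if h: "h \<in> R" "h' \<in> R'"
    and approx: "\<forall>e>0. \<exists>(g, g')\<in>S. sqrt ((nrm ip (h - g))\<^sup>2 + (nrm ip' (h' - g'))\<^sup>2) < e" for h h'
  proof -
    have "nrm ip' (h' - T h) \<le> 0 + e" if "e > 0" for e
    proof -
      obtain g g' where "(g, g') \<in> S" and close: "sqrt ((nrm ip (h - g))\<^sup>2 + (nrm ip' (h' - g'))\<^sup>2) < e / 2"
        using approx \<open>e > 0\<close> half_gt_zero by fast
      then have g: "g \<in> R" "g' = T g"
        using S_graph by auto
      have "nrm ip (h - g) < e / 2" "nrm ip' (h' - T g) < e / 2"
        using le_less_trans[OF real_sqrt_sum_squares_ge1 close] le_less_trans[OF real_sqrt_sum_squares_ge2 close]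
        unfolding g(2) .
      moreover have "nrm ip' (T h - T g) = nrm ip (h - g)"
        using T_nrm[of "h - g"] h g by (simp add: T_diff)
      ultimately show ?thesis
        using M'.nrm_triangle3[of h' "T h" "T g"] h g T_mem by simp
    qed
    then have "nrm ip' (h' - T h) \<le> 0"
      by (rule field_le_epsilon)
    then have "nrm ip' (h' - T h) = 0"
      by (rule antisym) (use h T_mem in simp)
    then show ?thesis
      using M'.nrm_eq_0[of "h' - T h"] h T_mem by simp
  qed
  moreover have "\<exists>(g, g')\<in>S. sqrt ((nrm ip (h - g))\<^sup>2 + (nrm ip' (T h - g'))\<^sup>2) < e"
    if h: "h \<in> R" and e: "e > 0" for h e
  proof -
    have "h \<in> hclosure R ip (fspan {mult \<phi> (f i) | \<phi> i. \<phi> \<in> A_alg \<Omega>})"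
      using M.generating h by (simp add: generating_set_def)
    then obtain g where g: "g \<in> fspan {mult \<phi> (f i) | \<phi> i. \<phi> \<in> A_alg \<Omega>}" and close: "nrm ip (h - g) < e / 2"
      unfolding hclosure_def using half_gt_zero[OF e] by blast
    obtain K :: nat and c G where G: "\<And>k. k < K \<Longrightarrow> G k \<in> {mult \<phi> (f i) | \<phi> i. \<phi> \<in> A_alg \<Omega>}"
      and g_eq: "g = (\<lambda>w. \<Sum>k<K. c k *s G k w)"
      using fspanE[OF g] by blast
    then have "\<forall>k. \<exists>\<phi> i. k < K \<longrightarrow> G k = mult \<phi> (f i) \<and> \<phi> \<in> A_alg \<Omega>"
      by blast
    then obtain \<phi> i where \<phi>: "\<And>k. k < K \<Longrightarrow> G k = mult (\<phi> k) (f (i k)) \<and> \<phi> k \<in> A_alg \<Omega>"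
      by metis
    have g_eq': "g = (\<lambda>w. \<Sum>k<K. c k *s mult (\<phi> k) (f (i k)) w)"
      using \<phi> by (simp add: g_eq)
    then have Tg: "T g = (\<lambda>w. \<Sum>k<K. c k *s mult (\<phi> k) (f' (i k)) w)"
      by (simp add: T_lincomb T_mult T_f)
    have gS: "(g, T g) \<in> S"
      unfolding S_def using \<phi> g_eq' Tg by blast
    then have "g \<in> R"
      using S_graph by blast
    then have "nrm ip' (T h - T g) = nrm ip (h - g)" "0 \<le> nrm ip (h - g)"
      using T_nrm[of "h - g"] h by (simp_all add: T_diff)
    \<comment> \<open>Both components have the same norm, less than \<open>e / 2\<close>, and the
      root is at most their sum.\<close>
    then have "sqrt ((nrm ip (h - g))\<^sup>2 + (nrm ip' (T h - T g))\<^sup>2) < e"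
      using close sqrt_sum_squares_le_sum[of "nrm ip (h - g)" "nrm ip (h - g)"] by simp
    then show ?thesis
      using gS by blast
  qed
  ultimately show ?thesis
    unfolding delta using T_mem by blast
qed

end

theorem theorem3:
  fixes \<Omega> :: "(complex^'n) set"
    and R R' :: "('n, 'm::finite) vfun set"
    and ip ip' :: "('n, 'm) vfun \<Rightarrow> ('n, 'm) vfun \<Rightarrow> complex"
    and f f' :: "'m \<Rightarrow> ('n, 'm) vfun"
  assumes "bounded \<Omega>" and "open \<Omega>" and "connected \<Omega>" and "\<Omega> \<noteq> {}"
    and "quasi_free \<Omega> R ip" and "quasi_free \<Omega> R' ip'"
    and "generating_set \<Omega> R ip f" and "generating_set \<Omega> R' ip' f'"
    and "\<forall>z\<in>\<Omega>. \<forall>i j. loc_ip \<Omega> R ip z (f i) (f j) = loc_ip \<Omega> R' ip' z (f' i) (f' j)"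
  shows "isometric_module_map \<Omega> R ip R' ip' (delta_graph \<Omega> R ip R' ip' f f')
         \<and> unitarily_equiv \<Omega> R ip R' ip'"
proof -
  interpret P: matched_modules \<Omega> R R' ip ip' f f'
    using assms by unfold_locales auto
  \<comment> \<open>With the frames exchanged, \<open>Q.T\<close> undoes \<open>P.T\<close> on each
    fibre; together with \<open>Q.T_mem\<close> this makes \<open>P.T\<close> onto
    \<open>R'\<close>.\<close>
  interpret Q: matched_modules \<Omega> R' R ip' ip f' f
    using assms by unfold_locales auto
  have inverse: "Q.T (P.T h) = h" if "h \<in> R" for h
    using that by (auto simp: fun_eq_iff Q.T_def P.cmat_T P.M.gmat_cmat)
  have inverse': "P.T (Q.T h) = h" if "h \<in> R'" for h
    using that by (auto simp: fun_eq_iff P.T_def Q.cmat_T P.M'.gmat_cmat)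
  have "bij_betw P.T R R'"
    by (rule bij_betw_byWitness[where f' = Q.T]) (auto simp: inverse inverse' P.T_mem Q.T_mem)
  then have "unitarily_equiv \<Omega> R ip R' ip'"
    unfolding unitarily_equiv_def using P.T_add P.T_smult P.T_ip P.T_mult by blast
  moreover have "isometric_module_map \<Omega> R ip R' ip' (delta_graph \<Omega> R ip R' ip' f f')"
    unfolding isometric_module_map_def P.delta_graph_eq
    using P.T_mem P.T_add P.T_smult P.T_nrm P.T_mult by blast
  ultimately show ?thesis by blast
qed

end
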